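(* Let $\mathbb{F}$ be a field. For all nonempty finite metric spaces $(X,d_X)$, $(Y,d_Y)$ and all integers $k\ge 0$, $$2\cdot d_{\mathrm{GH}}\big((X,d_X),(Y,d_Y)\big)\;\ge\; d_{\mathrm{I}}\big(H_k(\mathrm{K}^{\mathrm{VR}}_\bullet(X),\mathbb{F}),\,H_k(\mathrm{K}^{\mathrm{VR}}_\bullet(Y),\mathbb{F})\big).$$
   Context: **Vietoris-Rips complex.** For a finite metric space $(X,d_X)$ and $\delta\ge 0$, $\mathrm{K}^{\mathrm{VR}}_\delta(X)$ is the abstract simplicial complex of all nonempty $\sigma\subseteq X$ with $\mathrm{diam}(\sigma)=\max_{x,x'\in\sigma}d_X(x,x')\le\delta$. For $\delta\le\delta'$ there is the inclusion $\mathrm{K}^{\mathrm{VR}}_\delta(X)\subseteq \mathrm{K}^{\mathrm{VR}}_{\delta'}(X)$. $H_k(\cdot,\mathbb{F})$ is simplicial homology with coefficients in $\mathbb{F}$. **Persistence vector spaces.** A persistence vector space $\mathbb{V}$ over $\mathbb{F}$ is a family of $\mathbb{F}$-vector spaces $\{V_\delta\}_{\delta\in[0,\infty)}$ with linear maps $v_{\delta,\delta'}:V_\delta\to V_{\delta'}$ for $\delta\le\delta'$, such that $v_{\delta,\delta}=\mathrm{id}$ and $v_{\delta,\delta''}=v_{\delta',\delta''}\circ v_{\delta,\delta'}$ for $\delta\le\delta'\le\delta''$. $H_k(\mathrm{K}^{\mathrm{VR}}_\bullet(X),\mathbb{F})$ is the persistence vector space with spaces $H_k(\mathrm{K}^{\mathrm{VR}}_\delta(X),\mathbb{F})$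 and maps induced by the inclusions. **Interleaving distance.** For $\eta\ge 0$, an $\eta$-interleaving between $\mathbb{V}$ and $\mathbb{W}$ consists of linear maps $\alpha_\delta:V_\delta\to W_{\delta+\eta}$ and $\beta_\delta:W_\delta\to V_{\delta+\eta}$ for all $\delta\ge0$ such that, for all $0\le\delta\le\delta'$: $\beta_{\delta+\eta}\circ\alpha_\delta=v_{\delta,\delta+2\eta}$, $\alpha_{\delta+\eta}\circ\beta_\delta=w_{\delta,\delta+2\eta}$, $\alpha_{\delta'}\circ v_{\delta,\delta'}=w_{\delta+\eta,\delta'+\eta}\circ\alpha_\delta$, and $\beta_{\delta'}\circ w_{\delta,\delta'}=v_{\delta+\eta,\delta'+\eta}\circ\beta_\delta$. The interleaving distance is $d_{\mathrm{I}}(\mathbb{V},\mathbb{W})=\inf\{\eta\ge0 : \mathbb{V}\text{ and }\mathbb{W}\text{ are }\eta\text{-interleaved}\}\in[0,\infty]$. **Gromov-Hausdorff distance.** For maps of sets $\phi:X\to Y$ and $\psi:Y\to X$, set $\mathrm{dis}(\phi)=\max_{x,x'\in X}|d_X(x,x')-d_Y(\phi(x),\phi(x'))|$, $\mathrm{dis}(\psi)=\max_{y,y'\in Y}|d_Y(y,y')-d_X(\psi(y),\psi(y'))|$, and $C(\phi,\psi)=\max_{x\in X,y\in Y}|d_X(x,\psi(y))-d_Y(y,\phi(x))|$. For $\eta\ge0$, the pair $(\phi,\psi)$ is an $\eta$-isometry between $X$ and $Y$ if $\mathrm{dis}(\phi)\le\eta$, $\mathrm{dis}(\psi)\le\eta$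 and $C(\phi,\psi)\le\eta$. Then $$d_{\mathrm{GH}}((X,d_X),(Y,d_Y))=\tfrac12\min\{\eta\ge0 : \text{there is an }\eta\text{-isometry between }X\text{ and }Y\}.$$ *)

theory Defs
  imports
    "HOL-Library.Extended_Real"
    "HOL-Algebra.AbelCoset"
    "HOL-Combinatorics.Permutations"
    "HOL-Analysis.Abstract_Metric_Spaces"
    "Jordan_Normal_Form.VS_Connect"
begin

section \<open>Persistence vector spaces and the interleaving distance\<close>

text \<open>The parameter ranges over the reals; only its values in $[0,\infty)$ are relevant.\<close>

record ('f, 'v) persistence =
  pspace :: "real \<Rightarrow> ('f, 'v) module"
  pmap :: "real \<Rightarrow> real \<Rightarrow> 'v \<Rightarrow> 'v"

locale persistence_vector_space =
  fixes K :: "('f, 'c) ring_scheme" and V :: "('f, 'v) persistence"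
  assumes pmap_linear:
      "\<And>s t. \<lbrakk>0 \<le> s; s \<le> t\<rbrakk> \<Longrightarrow> linear_map K (pspace V s) (pspace V t) (pmap V s t)"
    and pmap_id:
      "\<And>s x. \<lbrakk>0 \<le> s; x \<in> carrier (pspace V s)\<rbrakk> \<Longrightarrow> pmap V s s x = x"
    and pmap_comp:
      "\<And>s t u x. \<lbrakk>0 \<le> s; s \<le> t; t \<le> u; x \<in> carrier (pspace V s)\<rbrakk>
        \<Longrightarrow> pmap V s u x = pmap V t u (pmap V s t x)"

definition interleaving ::
  "('f, 'c) ring_scheme \<Rightarrow> ('f, 'v) persistence \<Rightarrow> ('f, 'w) persistence \<Rightarrow> real
    \<Rightarrow> (real \<Rightarrow> 'v \<Rightarrow> 'w) \<Rightarrow> (real \<Rightarrow> 'w \<Rightarrow> 'v) \<Rightarrow> bool" where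
  "interleaving K V W \<eta> \<alpha> \<beta> \<longleftrightarrow>
    (\<forall>s\<ge>0. linear_map K (pspace V s) (pspace W (s + \<eta>)) (\<alpha> s)) \<and>
    (\<forall>s\<ge>0. linear_map K (pspace W s) (pspace V (s + \<eta>)) (\<beta> s)) \<and>
    (\<forall>s\<ge>0. \<forall>x\<in>carrier (pspace V s). \<beta> (s + \<eta>) (\<alpha> s x) = pmap V s (s + 2 * \<eta>) x) \<and>
    (\<forall>s\<ge>0. \<forall>y\<in>carrier (pspace W s). \<alpha> (s + \<eta>) (\<beta> s y) = pmap W s (s + 2 * \<eta>) y) \<and>
    (\<forall>s\<ge>0. \<forall>t\<ge>s. \<forall>x\<in>carrier (pspace V s).
      \<alpha> t (pmap V s t x) = pmap W (s + \<eta>) (t + \<eta>) (\<alpha> s x)) \<and>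
    (\<forall>s\<ge>0. \<forall>t\<ge>s. \<forall>y\<in>carrier (pspace W s).
      \<beta> t (pmap W s t y) = pmap V (s + \<eta>) (t + \<eta>) (\<beta> s y))"

definition interleaved ::
  "('f, 'c) ring_scheme \<Rightarrow> ('f, 'v) persistence \<Rightarrow> ('f, 'w) persistence \<Rightarrow> real \<Rightarrow> bool" where
  "interleaved K V W \<eta> \<longleftrightarrow> (\<exists>\<alpha> \<beta>. interleaving K V W \<eta> \<alpha> \<beta>)"

definition interleaving_distance ::
  "('f, 'c) ring_scheme \<Rightarrow> ('f, 'v) persistence \<Rightarrow> ('f, 'w) persistence \<Rightarrow> ereal" where
  "interleaving_distance K V W = (INF \<eta>\<in>{\<eta>. 0 \<le> \<eta> \<and> interleaved K V W \<eta>}. ereal \<eta>)"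


section \<open>Simplicial homology of a finite complex with field coefficients\<close>

text \<open>
  Oriented chains. An ordered simplex is a list without repetitions whose set of entries is a
  simplex; two orderings that differ by a permutation \<open>p\<close> represent orientations that differ by
  the sign of \<open>p\<close>. A \<open>k\<close>-chain is a function on ordered \<open>k\<close>-simplices that changes by the sign
  when the ordering is permuted, extended by 0 to all other lists.
\<close>

definition ordered_simplices :: "'a set set \<Rightarrow> nat \<Rightarrow> 'a list set" where
  "ordered_simplices \<K> k = {xs. distinct xs \<and> length xs = Suc k \<and> set xs \<in> \<K>}"

definition oriented_chains :: "'a set set \<Rightarrow> nat \<Rightarrow> ('a list \<Rightarrow> 'f::field) set" where
  "oriented_chains \<K> k = {c. (\<forall>xs. xs \<notin> ordered_simplices \<K> k \<longrightarrow> c xs = 0) \<and>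
    (\<forall>xs \<in> ordered_simplices \<K> k. \<forall>p. p permutes {..<length xs} \<longrightarrow>
      c (permute_list p xs) = of_int (sign p) * c xs)}"

text \<open>
  The elementary chain $[x_0,\dots,x_k]$: it takes the value \<open>sign p\<close> on the permutation of
  \<open>xs\<close> by \<open>p\<close>, and 0 on every list that is not a permutation of \<open>xs\<close>. (The entries of \<open>xs\<close> being
  distinct, at most one summand is nonzero.)
\<close>

definition elementary_chain :: "'a list \<Rightarrow> 'a list \<Rightarrow> 'f::field" where
  "elementary_chain xs =
    (\<lambda>ys. \<Sum>p | p permutes {..<length xs}. if ys = permute_list p xs then of_int (sign p) else 0)"

definition face :: "nat \<Rightarrow> 'a list \<Rightarrow> 'a list" where
  "face i xs = take i xs @ drop (Suc i) xs"

text \<open>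
  An arbitrary ordering of the vertices of a simplex. In \<open>boundary\<close> below, the summand
  $c(xs)\,\partial[xs]$ does not depend on the ordering \<open>xs\<close> of the simplex.
\<close>

definition some_ordering :: "'a set \<Rightarrow> 'a list" where
  "some_ordering \<sigma> = (SOME xs. distinct xs \<and> set xs = \<sigma>)"

text \<open>
  The linear extension of
  $\partial[x_0,\dots,x_k] = \sum_{i=0}^{k} (-1)^i [x_0,\dots,\widehat{x_i},\dots,x_k]$
  for $k \ge 1$, and 0 on 0-chains (homology is not reduced).
\<close>

definition boundary :: "'a set set \<Rightarrow> nat \<Rightarrow> ('a list \<Rightarrow> 'f::field) \<Rightarrow> 'a list \<Rightarrow> 'f" where
  "boundary \<K> k c = (if k = 0 then (\<lambda>_. 0) else
    (\<lambda>ys. \<Sum>\<sigma> | \<sigma> \<in> \<K> \<and> card \<sigma> = Suc k.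
      c (some_ordering \<sigma>) * (\<Sum>i\<le>k. (-1) ^ i * elementary_chain (face i (some_ordering \<sigma>)) ys)))"

definition cycles :: "'a set set \<Rightarrow> nat \<Rightarrow> ('a list \<Rightarrow> 'f::field) set" where
  "cycles \<K> k = {c \<in> oriented_chains \<K> k. boundary \<K> k c = (\<lambda>_. 0)}"

definition boundaries :: "'a set set \<Rightarrow> nat \<Rightarrow> ('a list \<Rightarrow> 'f::field) set" where
  "boundaries \<K> k = boundary \<K> (Suc k) ` oriented_chains \<K> (Suc k)"

text \<open>The fields \<open>mult\<close> and \<open>one\<close> of a module record are irrelevant.\<close>

definition cycle_space :: "'a set set \<Rightarrow> nat \<Rightarrow> ('f::field, 'a list \<Rightarrow> 'f) module" where
  "cycle_space \<K> k =
    \<lparr>carrier = cycles \<K> k, mult = undefined, one = undefined,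
     zero = (\<lambda>_. 0), add = (\<lambda>c d xs. c xs + d xs), smult = (\<lambda>a c xs. a * c xs)\<rparr>"

definition quotient_module :: "('f, 'v) module \<Rightarrow> 'v set \<Rightarrow> ('f, 'v set) module" where
  "quotient_module M N =
    \<lparr>carrier = a_rcosets\<^bsub>M\<^esub> N, mult = undefined, one = undefined,
     zero = N, add = (\<lambda>A B. A <+>\<^bsub>M\<^esub> B), smult = (\<lambda>a A. \<Union>x\<in>A. N +>\<^bsub>M\<^esub> (a \<odot>\<^bsub>M\<^esub> x))\<rparr>"

definition homology :: "'a set set \<Rightarrow> nat \<Rightarrow> ('f::field, ('a list \<Rightarrow> 'f) set) module" where
  "homology \<K> k = quotient_module (cycle_space \<K> k) (boundaries \<K> k)"

text \<open>
  The map $H_k(\mathcal K) \to H_k(\mathcal L)$ induced by an inclusion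
  $\mathcal K \subseteq \mathcal L$. As chains are extended by 0, the inclusion acts as the
  identity on them, and the class of a cycle \<open>c\<close> is sent to the class of \<open>c\<close> in the larger complex.
\<close>

definition homology_inclusion ::
  "'a set set \<Rightarrow> nat \<Rightarrow> ('a list \<Rightarrow> 'f::field) set \<Rightarrow> ('a list \<Rightarrow> 'f) set" where
  "homology_inclusion \<L> k A = (\<Union>c\<in>A. boundaries \<L> k +>\<^bsub>cycle_space \<L> k\<^esub> c)"


section \<open>Vietoris--Rips complexes of finite metric spaces\<close>

definition diam :: "('a \<Rightarrow> 'a \<Rightarrow> real) \<Rightarrow> 'a set \<Rightarrow> real" where
  "diam d \<sigma> = Max ((\<lambda>(x, x'). d x x') ` (\<sigma> \<times> \<sigma>))"

definition vietoris_rips :: "'a set \<Rightarrow> ('a \<Rightarrow> 'a \<Rightarrow> real) \<Rightarrow> real \<Rightarrow> 'a set set" where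
  "vietoris_rips X d \<delta> = {\<sigma>. \<sigma> \<noteq> {} \<and> \<sigma> \<subseteq> X \<and> diam d \<sigma> \<le> \<delta>}"

definition vietoris_rips_homology ::
  "nat \<Rightarrow> 'a set \<Rightarrow> ('a \<Rightarrow> 'a \<Rightarrow> real) \<Rightarrow> ('f::field, ('a list \<Rightarrow> 'f) set) persistence" where
  "vietoris_rips_homology k X d =
    \<lparr>pspace = (\<lambda>\<delta>. homology (vietoris_rips X d \<delta>) k),
     pmap = (\<lambda>\<delta> \<delta>'. homology_inclusion (vietoris_rips X d \<delta>') k)\<rparr>"


section \<open>The Gromov--Hausdorff distance of finite metric spaces\<close>

definition distortion ::
  "'a set \<Rightarrow> ('a \<Rightarrow> 'a \<Rightarrow> real) \<Rightarrow> ('b \<Rightarrow> 'b \<Rightarrow> real) \<Rightarrow> ('a \<Rightarrow> 'b) \<Rightarrow> real" where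
  "distortion X dX dY \<phi> = Max ((\<lambda>(x, x'). \<bar>dX x x' - dY (\<phi> x) (\<phi> x')\<bar>) ` (X \<times> X))"

definition codistortion ::
  "'a set \<Rightarrow> ('a \<Rightarrow> 'a \<Rightarrow> real) \<Rightarrow> 'b set \<Rightarrow> ('b \<Rightarrow> 'b \<Rightarrow> real)
    \<Rightarrow> ('a \<Rightarrow> 'b) \<Rightarrow> ('b \<Rightarrow> 'a) \<Rightarrow> real" where
  "codistortion X dX Y dY \<phi> \<psi> =
    Max ((\<lambda>(x, y). \<bar>dX x (\<psi> y) - dY y (\<phi> x)\<bar>) ` (X \<times> Y))"

definition eta_isometry ::
  "'a set \<Rightarrow> ('a \<Rightarrow> 'a \<Rightarrow> real) \<Rightarrow> 'b set \<Rightarrow> ('b \<Rightarrow> 'b \<Rightarrow> real) \<Rightarrow> real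
    \<Rightarrow> ('a \<Rightarrow> 'b) \<Rightarrow> ('b \<Rightarrow> 'a) \<Rightarrow> bool" where
  "eta_isometry X dX Y dY \<eta> \<phi> \<psi> \<longleftrightarrow>
    \<phi> \<in> X \<rightarrow> Y \<and> \<psi> \<in> Y \<rightarrow> X \<and>
    distortion X dX dY \<phi> \<le> \<eta> \<and> distortion Y dY dX \<psi> \<le> \<eta> \<and>
    codistortion X dX Y dY \<phi> \<psi> \<le> \<eta>"

text \<open>
  \<open>LEAST\<close> renders the minimum; it is attained because \<open>X\<close> and \<open>Y\<close> are finite and nonempty, so
  that only finitely many values of the distortions and codistortions occur.
\<close>

definition gromov_hausdorff ::
  "'a set \<Rightarrow> ('a \<Rightarrow> 'a \<Rightarrow> real) \<Rightarrow> 'b set \<Rightarrow> ('b \<Rightarrow> 'b \<Rightarrow> real) \<Rightarrow> real" where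
  "gromov_hausdorff X dX Y dY =
    1 / 2 * (LEAST \<eta>. 0 \<le> \<eta> \<and> (\<exists>\<phi> \<psi>. eta_isometry X dX Y dY \<eta> \<phi> \<psi>))"


section \<open>Vietoris--Rips homology is a persistence vector space\<close>

definition alternating :: "('a list \<Rightarrow> 'f::field) \<Rightarrow> bool" where
  "alternating c \<longleftrightarrow> (\<forall>xs p. p permutes {..<length xs} \<longrightarrow> c (permute_list p xs) = of_int (sign p) * c xs)"

lemma ordered_simplices_permute:
  "p permutes {..<length xs} \<Longrightarrow> permute_list p xs \<in> ordered_simplices \<K> k \<longleftrightarrow> xs \<in> ordered_simplices \<K> k"
  by (simp add: ordered_simplices_def)

lemma chains_alt: "c \<in> oriented_chains \<K> k \<Longrightarrow> alternating c"
proof -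
  assume c: "c \<in> oriented_chains \<K> k"
  have "c (permute_list p xs) = of_int (sign p) * c xs" if "p permutes {..<length xs}" for xs p
  proof (cases "xs \<in> ordered_simplices \<K> k")
    case True then show ?thesis using c that by (simp add: oriented_chains_def)
  next
    case False
    then have "permute_list p xs \<notin> ordered_simplices \<K> k"
      using ordered_simplices_permute[OF that] by blast
    then show ?thesis using c False by (simp add: oriented_chains_def)
  qed
  then show ?thesis by (simp add: alternating_def)
qed

lemma chains_iff: "c \<in> oriented_chains \<K> k \<longleftrightarrow> alternating c \<and> (\<forall>xs. xs \<notin> ordered_simplices \<K> k \<longrightarrow> c xs = 0)"
proof
  assume c: "c \<in> oriented_chains \<K> k"
  then show "alternating c \<and> (\<forall>xs. xs \<notin> ordered_simplices \<K> k \<longrightarrow> c xs = 0)"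
    using chains_alt[OF c] unfolding oriented_chains_def by blast
next
  assume "alternating c \<and> (\<forall>xs. xs \<notin> ordered_simplices \<K> k \<longrightarrow> c xs = 0)"
  then show "c \<in> oriented_chains \<K> k"
    unfolding oriented_chains_def alternating_def by blast
qed

lemma altD: "alternating c \<Longrightarrow> p permutes {..<length xs} \<Longrightarrow> c (permute_list p xs) = of_int (sign p) * c xs"
  by (simp add: alternating_def)

lemma alt_swap:
  assumes "alternating c" "a < length xs" "b < length xs" "a \<noteq> b"
  shows "c (permute_list (Transposition.transpose a b) xs) = - c xs"
  using altD[OF assms(1) permutes_swap_id, of a xs b] assms by (simp add: sign_swap_id)

lemma alt_adjacent:
  assumes "alternating c"
  shows "c (us @ v # u # vs) = - c (us @ u # v # vs)"
proof -
  let ?xs = "us @ u # v # vs" and ?n = "length us"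
  have "permute_list (Transposition.transpose ?n (Suc ?n)) ?xs = us @ v # u # vs"
  proof (rule nth_equalityI)
    fix i assume "i < length (permute_list (Transposition.transpose ?n (Suc ?n)) ?xs)"
    then have i: "i < length ?xs" by simp
    then have eq: "permute_list (Transposition.transpose ?n (Suc ?n)) ?xs ! i
        = ?xs ! Transposition.transpose ?n (Suc ?n) i"
      by (simp add: permute_list_def del: upt_Suc)
    consider "i < ?n" | "i = ?n" | "i = Suc ?n" | j where "i = ?n + Suc (Suc j)"
      using less_imp_Suc_add[of "Suc ?n" i] by fastforce
    then show "permute_list (Transposition.transpose ?n (Suc ?n)) ?xs ! i = (us @ v # u # vs) ! i"
      unfolding eq by cases (auto simp: nth_append Transposition.transpose_def)
  qed simp
  then show ?thesis using alt_swap[OF assms, of ?n ?xs "Suc ?n"] by simp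
qed

lemma alt_front:
  assumes "alternating c"
  shows "c (us @ v # vs) = (-1) ^ length us * c (v # us @ vs)"
proof (induction us arbitrary: vs rule: rev_induct)
  case (snoc u us)
  have "c ((us @ [u]) @ v # vs) = - c (us @ v # u # vs)"
    using alt_adjacent[OF assms, of us u v vs] by simp
  also have "\<dots> = - ((-1) ^ length us * c (v # us @ u # vs))"
    by (simp add: snoc)
  finally show ?case by simp
qed simp

lemma alt_face:
  assumes "alternating c" "i < length xs"
  shows "c xs = (-1) ^ i * c (xs ! i # face i xs)"
  using alt_front[OF assms(1), of "take i xs" "xs ! i" "drop (Suc i) xs"] assms(2)
  by (simp add: face_def flip: id_take_nth_drop)

lemma alt_Cons:
  assumes "alternating c" "p permutes {..<length xs}"
  shows "c (x # permute_list p xs) = of_int (sign p) * c (x # xs)"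
  using finite_lessThan assms(2)
proof (induction p rule: permutes_rev_induct)
  case (swap a b p)
  let ?t = "Transposition.transpose a b" and ?t' = "Transposition.transpose (Suc a) (Suc b)"
  let ?ys = "permute_list p xs"
  have t: "?t permutes {..<length xs}"
    using swap by (intro permutes_swap_id)
  have "x # permute_list ?t ?ys = permute_list ?t' (x # ?ys)"
  proof (rule nth_equalityI)
    fix i assume "i < length (x # permute_list ?t ?ys)"
    then show "(x # permute_list ?t ?ys) ! i = permute_list ?t' (x # ?ys) ! i"
      by (cases i) (auto simp: permute_list_def Transposition.transpose_def simp del: upt_Suc)
  qed simp
  then have "c (x # permute_list (p \<circ> ?t) xs) = - c (x # ?ys)"
    using alt_swap[OF assms(1), of "Suc a" "x # ?ys" "Suc b"] swap permute_list_compose[OF t, of p]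
    by simp
  moreover have "sign (p \<circ> ?t) = - sign p"
    using swap sign_compose[of p ?t] permutation_swap_id[of a b] permutes_imp_permutation[of "{..<length xs}" p]
    by (simp add: sign_swap_id)
  ultimately show ?case using swap by (simp only: of_int_minus mult_minus_left)
qed (simp add: sign_id)

lemma permute_list_inj:
  assumes "distinct xs" "p permutes {..<length xs}" "q permutes {..<length xs}"
    and "permute_list p xs = permute_list q xs"
  shows "p = q"
proof
  fix i show "p i = q i"
  proof (cases "i < length xs")
    case True
    then have "xs ! p i = xs ! q i"
      using permute_list_nth[OF assms(2)] permute_list_nth[OF assms(3)] assms(4) by metis
    then show ?thesis
      using True assms(1) permutes_in_image[OF assms(2), of i] permutes_in_image[OF assms(3), of i]
      by (simp add: nth_eq_iff_index_eq)
  next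
    case False then show ?thesis using assms(2,3) by (simp add: permutes_not_in)
  qed
qed

lemma elementary_chain_permute:
  assumes "distinct xs" "p permutes {..<length xs}"
  shows "elementary_chain xs (permute_list p xs) = (of_int (sign p) :: 'f::field)"
proof -
  have "elementary_chain xs (permute_list p xs)
      = (\<Sum>q | q permutes {..<length xs}. if q = p then of_int (sign p) else (0::'f))"
    unfolding elementary_chain_def using permute_list_inj[OF assms(1) assms(2)]
    by (intro sum.cong) auto
  then show ?thesis using assms(2) by (simp add: finite_permutations)
qed

lemma elementary_chain_0:
  assumes "\<nexists>p. p permutes {..<length xs} \<and> ys = permute_list p xs"
  shows "elementary_chain xs ys = 0"
  unfolding elementary_chain_def using assms by (intro sum.neutral) auto

lemma elementary_chain_chain:
  assumes "alternating c" "distinct xs" "set (face i xs) = set xs - {xs ! i}" "distinct (face i xs)" "i < length xs"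
  shows "c xs * ((-1) ^ i * elementary_chain (face i xs) ys)
    = (if distinct ys \<and> set ys = set xs - {xs ! i} then c (xs ! i # ys) else 0)"
proof (cases "\<exists>p. p permutes {..<length (face i xs)} \<and> ys = permute_list p (face i xs)")
  case True
  then obtain p where p: "p permutes {..<length (face i xs)}" "ys = permute_list p (face i xs)" by blast
  have "c (xs ! i # ys) = of_int (sign p) * c (xs ! i # face i xs)"
    using alt_Cons[OF assms(1) p(1)] p(2) by simp
  moreover have "c xs = (-1) ^ i * c (xs ! i # face i xs)" using alt_face assms by blast
  moreover have "(-1::'b) ^ i * (-1) ^ i = 1" by (simp flip: power_add)
  ultimately have "c xs * ((-1) ^ i * elementary_chain (face i xs) ys) = c (xs ! i # ys)"
    using elementary_chain_permute[OF assms(4) p(1), where ?'f='b] p(2)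
    by (simp add: mult.assoc mult.left_commute[of "(-1) ^ i"])
  then show ?thesis using p assms(3,4) by simp
next
  case False
  have "\<not> (distinct ys \<and> set ys = set xs - {xs ! i})"
  proof
    assume "distinct ys \<and> set ys = set xs - {xs ! i}"
    then have "mset ys = mset (face i xs)"
      using assms(3,4) set_eq_iff_mset_eq_distinct[of ys "face i xs"] by simp
    then obtain p where "p permutes {..<length (face i xs)}" "permute_list p (face i xs) = ys"
      by (rule mset_eq_permutation)
    then show False using False by blast
  qed
  then show ?thesis using elementary_chain_0[OF False] by auto
qed

lemma face_distinct:
  assumes "distinct xs" "i < length xs"
  shows "distinct (face i xs)" "set (face i xs) = set xs - {xs ! i}"
proof -
  obtain us v vs where *: "xs = us @ v # vs" "i = length us"
    using assms(2) id_take_nth_drop[of i xs] by (metis length_take min_absorb2 less_imp_le)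
  then show "distinct (face i xs)" "set (face i xs) = set xs - {xs ! i}"
    using assms(1) by (auto simp: face_def)
qed

lemma some_ordering: "finite \<sigma> \<Longrightarrow> distinct (some_ordering \<sigma>) \<and> set (some_ordering \<sigma>) = \<sigma>"
  unfolding some_ordering_def by (rule someI_ex) (metis finite_distinct_list)

lemma boundary_summand:
  assumes "alternating c" "card \<sigma> = Suc k"
  shows "c (some_ordering \<sigma>) * (\<Sum>i\<le>k. (-1) ^ i * elementary_chain (face i (some_ordering \<sigma>)) ys)
   = (\<Sum>v\<in>\<sigma>. if distinct ys \<and> set ys = \<sigma> - {v} then c (v # ys) else 0)"
proof -
  let ?xs = "some_ordering \<sigma>"
  have "finite \<sigma>" using assms(2) card.infinite by fastforce
  from some_ordering[OF this] have xs: "distinct ?xs" "set ?xs = \<sigma>" by auto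
  then have len: "length ?xs = Suc k" using assms(2) distinct_card by metis
  have "c ?xs * (\<Sum>i\<le>k. (-1) ^ i * elementary_chain (face i ?xs) ys)
     = (\<Sum>i\<le>k. if distinct ys \<and> set ys = \<sigma> - {?xs ! i} then c (?xs ! i # ys) else 0)"
    unfolding sum_distrib_left
  proof (intro sum.cong refl)
    fix i assume "i \<in> {..k}"
    then have i: "i < length ?xs" using len by simp
    show "c ?xs * ((-1) ^ i * elementary_chain (face i ?xs) ys)
      = (if distinct ys \<and> set ys = \<sigma> - {?xs ! i} then c (?xs ! i # ys) else 0)"
      using elementary_chain_chain[OF assms(1) xs(1) face_distinct(2,1)[OF xs(1) i] i] xs(2) by simp
  qed
  also have "\<dots> = (\<Sum>v\<in>\<sigma>. if distinct ys \<and> set ys = \<sigma> - {v} then c (v # ys) else 0)"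
    by (rule sum.reindex_bij_betw, rule bij_betw_nth) (auto simp: xs len)
  finally show ?thesis .
qed

text \<open>
  The boundary formula in coordinates; in particular \<open>boundary\<close> does not depend on the orderings
  picked by \<open>some_ordering\<close>.
\<close>

lemma boundary_eq:
  assumes c: "c \<in> oriented_chains \<K> (Suc k)" and V: "finite V" "\<Union>\<K> \<subseteq> V"
  shows "boundary \<K> (Suc k) c ys = (\<Sum>v\<in>V. c (v # ys))"
proof -
  have fin: "finite {\<sigma>. \<sigma> \<in> \<K> \<and> card \<sigma> = Suc (Suc k)}"
  proof (rule finite_subset)
    show "{\<sigma>. \<sigma> \<in> \<K> \<and> card \<sigma> = Suc (Suc k)} \<subseteq> Pow V" using V(2) by blast
  qed (simp add: V(1))
  let ?f = "\<lambda>\<sigma> v. if distinct ys \<and> set ys = \<sigma> - {v} then c (v # ys) else 0"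
  have "boundary \<K> (Suc k) c ys = (\<Sum>\<sigma> | \<sigma> \<in> \<K> \<and> card \<sigma> = Suc (Suc k). \<Sum>v\<in>\<sigma>. ?f \<sigma> v)"
    unfolding boundary_def if_not_P[OF nat.distinct(2)]
    using boundary_summand[OF chains_alt[OF c], of _ "Suc k"] by (auto intro!: sum.cong)
  also have "\<dots> = (\<Sum>\<sigma> | \<sigma> \<in> \<K> \<and> card \<sigma> = Suc (Suc k). \<Sum>v\<in>V. if v \<in> \<sigma> then ?f \<sigma> v else 0)"
  proof (rule sum.cong[OF refl])
    fix \<sigma> assume "\<sigma> \<in> {\<sigma>. \<sigma> \<in> \<K> \<and> card \<sigma> = Suc (Suc k)}"
    then have "\<sigma> \<subseteq> V" using V(2) by blast
    then show "(\<Sum>v\<in>\<sigma>. ?f \<sigma> v) = (\<Sum>v\<in>V. if v \<in> \<sigma> then ?f \<sigma> v else 0)"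
      using V(1) by (subst sum.inter_restrict[symmetric]) (simp_all add: Int_absorb1)
  qed
  also have "\<dots> = (\<Sum>v\<in>V. \<Sum>\<sigma> | \<sigma> \<in> \<K> \<and> card \<sigma> = Suc (Suc k). if v \<in> \<sigma> then ?f \<sigma> v else 0)"
    by (rule sum.swap)
  also have "\<dots> = (\<Sum>v\<in>V. c (v # ys))"
  proof (rule sum.cong[OF refl])
    fix v assume "v \<in> V"
    show "(\<Sum>\<sigma> | \<sigma> \<in> \<K> \<and> card \<sigma> = Suc (Suc k). if v \<in> \<sigma> then ?f \<sigma> v else 0) = c (v # ys)"
    proof (cases "v # ys \<in> ordered_simplices \<K> (Suc k)")
      case True
      then have *: "distinct ys" "v \<notin> set ys" "insert v (set ys) \<in> \<K>" "card (insert v (set ys)) = Suc (Suc k)"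
        by (auto simp: ordered_simplices_def distinct_card)
      have "(\<Sum>\<sigma> | \<sigma> \<in> \<K> \<and> card \<sigma> = Suc (Suc k). if v \<in> \<sigma> then ?f \<sigma> v else 0)
         = (\<Sum>\<sigma> | \<sigma> \<in> \<K> \<and> card \<sigma> = Suc (Suc k). if \<sigma> = insert v (set ys) then c (v # ys) else 0)"
        using * by (intro sum.cong refl) auto
      then show ?thesis using fin * by simp
    next
      case False
      then have "c (v # ys) = 0" using c by (auto simp: oriented_chains_def)
      then show ?thesis by (intro trans[OF sum.neutral]) auto
    qed
  qed
  finally show ?thesis .
qed

lemma double_sum_zero:
  fixes f :: "'a \<Rightarrow> 'a \<Rightarrow> 'f::field"
  assumes "finite V" "\<And>v w. f v w = - f w v" "\<And>v. f v v = 0"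
  shows "(\<Sum>v\<in>V. \<Sum>w\<in>V. f v w) = 0"
  using assms(1)
proof induction
  case (insert x V)
  have "(\<Sum>w\<in>V. f x w) = - (\<Sum>v\<in>V. f v x)"
    unfolding sum_negf[symmetric] using assms(2) by (intro sum.cong refl)
  then show ?case using insert assms(3) by (simp add: sum.distrib)
qed simp

locale finite_complex =
  fixes \<K> :: "'a set set"
  assumes finU: "finite (\<Union>\<K>)"
    and down: "\<And>\<sigma> \<tau>. \<sigma> \<in> \<K> \<Longrightarrow> \<tau> \<subseteq> \<sigma> \<Longrightarrow> \<tau> \<noteq> {} \<Longrightarrow> \<tau> \<in> \<K>"
begin

lemma bd: "c \<in> oriented_chains \<K> (Suc k) \<Longrightarrow> boundary \<K> (Suc k) c = (\<lambda>ys. \<Sum>v\<in>\<Union>\<K>. c (v # ys))"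
  using boundary_eq[OF _ finU order_refl] by blast

lemma boundary_chain:
  assumes c: "(c :: 'a list \<Rightarrow> 'f::field) \<in> oriented_chains \<K> (Suc k)"
  shows "boundary \<K> (Suc k) c \<in> oriented_chains \<K> k"
  unfolding bd[OF c] chains_iff
proof (intro conjI allI impI)
  show "alternating (\<lambda>ys. \<Sum>v\<in>\<Union>\<K>. c (v # ys))"
    unfolding alternating_def using alt_Cons[OF chains_alt[OF c]] by (simp add: sum_distrib_left)
  fix xs assume xs: "xs \<notin> ordered_simplices \<K> k"
  show "(\<Sum>v\<in>\<Union>\<K>. c (v # xs)) = 0"
  proof (rule sum.neutral, rule ballI)
    fix v 
    have "v # xs \<notin> ordered_simplices \<K> (Suc k)"
    proof
      assume a: "v # xs \<in> ordered_simplices \<K> (Suc k)"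
      then have "set xs \<noteq> {}" "insert v (set xs) \<in> \<K>" by (auto simp: ordered_simplices_def)
      then have "set xs \<in> \<K>" using down[of "insert v (set xs)" "set xs"] by blast
      then show False using xs a by (simp add: ordered_simplices_def)
    qed
    then show "c (v # xs) = 0" using c by (auto simp: oriented_chains_def)
  qed
qed

lemma boundary_boundary:
  assumes c: "(c :: 'a list \<Rightarrow> 'f::field) \<in> oriented_chains \<K> (Suc k)"
  shows "boundary \<K> k (boundary \<K> (Suc k) c) = (\<lambda>_. 0)"
proof (cases k)
  case 0 then show ?thesis by (simp add: boundary_def)
next
  case (Suc n)
  have "(\<Sum>v\<in>\<Union>\<K>. \<Sum>w\<in>\<Union>\<K>. c (w # v # ys)) = 0" for ys
  proof (rule double_sum_zero[OF finU])
    show "c (w # v # ys) = - c (v # w # ys)" for v w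
      using alt_adjacent[OF chains_alt[OF c], of "[]" w v ys] by (simp only: append_Nil)
    show "c (v # v # ys) = 0" for v
      using c by (auto simp: oriented_chains_def ordered_simplices_def)
  qed
  then show ?thesis
    using bd[OF c] bd[of "boundary \<K> (Suc k) c" n] boundary_chain[OF c] Suc by simp
qed

lemma boundaries_cycles: "boundaries \<K> k \<subseteq> cycles \<K> k"
  using boundary_chain boundary_boundary by (auto simp: boundaries_def cycles_def)

end

lemma boundary_mono:
  assumes "finite_complex \<L>" "\<K> \<subseteq> \<L>" "c \<in> oriented_chains \<K> k"
  shows "c \<in> oriented_chains \<L> k" "boundary \<L> k c = boundary \<K> k c"
proof -
  show L: "c \<in> oriented_chains \<L> k" using assms(2,3) unfolding chains_iff ordered_simplices_def by blast
  show "boundary \<L> k c = boundary \<K> k c"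
  proof (cases k)
    case 0 then show ?thesis by (simp add: boundary_def)
  next
    case (Suc n)
    have U: "\<Union>\<K> \<subseteq> \<Union>\<L>" using assms(2) by (rule Sup_subset_mono)
    show ?thesis
      using boundary_eq[OF L[unfolded Suc] finite_complex.finU[OF assms(1)] order_refl]
        boundary_eq[OF assms(3)[unfolded Suc] finite_complex.finU[OF assms(1)] U] Suc by auto
  qed
qed

lemma chains_lin:
  "(\<lambda>_. 0) \<in> oriented_chains \<K> k"
  "c \<in> oriented_chains \<K> k \<Longrightarrow> d \<in> oriented_chains \<K> k \<Longrightarrow> (\<lambda>xs. c xs + d xs) \<in> oriented_chains \<K> k"
  "c \<in> oriented_chains \<K> k \<Longrightarrow> (\<lambda>xs. a * c xs) \<in> oriented_chains \<K> k"
  by (auto simp: oriented_chains_def algebra_simps)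

lemma boundary_lin:
  "boundary \<K> k (\<lambda>_. 0) = (\<lambda>_. 0)"
  "boundary \<K> k (\<lambda>xs. c xs + d xs) = (\<lambda>xs. boundary \<K> k c xs + boundary \<K> k d xs)"
  "boundary \<K> k (\<lambda>xs. a * c xs) = (\<lambda>xs. a * boundary \<K> k c xs)"
  by (auto simp: boundary_def algebra_simps sum.distrib sum_distrib_left)

lemma cycle_space_vectorspace: "vectorspace class_ring (cycle_space \<K> k :: ('f::field, 'a list \<Rightarrow> 'f) module)"
proof -
  have lin: "(\<lambda>_. 0) \<in> cycles \<K> k"
    "c \<in> cycles \<K> k \<Longrightarrow> d \<in> cycles \<K> k \<Longrightarrow> (\<lambda>xs. c xs + d xs) \<in> cycles \<K> k"
    "c \<in> cycles \<K> k \<Longrightarrow> (\<lambda>xs. a * c xs) \<in> cycles \<K> k"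
    for c d :: "'a list \<Rightarrow> 'f" and a
    by (auto simp: cycles_def chains_lin boundary_lin)
  have "abelian_group (cycle_space \<K> k :: ('f, 'a list \<Rightarrow> 'f) module)"
  proof (rule abelian_groupI)
    fix x assume "x \<in> carrier (cycle_space \<K> k :: ('f, 'a list \<Rightarrow> 'f) module)"
    then show "\<exists>y\<in>carrier (cycle_space \<K> k). y \<oplus>\<^bsub>cycle_space \<K> k\<^esub> x = \<zero>\<^bsub>cycle_space \<K> k\<^esub>"
      using lin(3)[of x "-1"] by (intro bexI[of _ "\<lambda>xs. - 1 * x xs"]) (auto simp: cycle_space_def)
  qed (auto simp: cycle_space_def lin algebra_simps)
  then have "module class_ring (cycle_space \<K> k :: ('f, 'a list \<Rightarrow> 'f) module)"
    by (intro moduleI) (auto simp: class_cring.cring_axioms cycle_space_def lin algebra_simps)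
  then show ?thesis by (simp add: vectorspace_def class_field.field_axioms)
qed

lemma quotient_vectorspace:
  fixes M :: "('f, 'v) module"
  assumes V: "vectorspace K M" and S: "submodule K N M"
  shows "vectorspace K (quotient_module M N)"
    and "carrier (quotient_module M N) = (\<lambda>x. N +>\<^bsub>M\<^esub> x) ` carrier M"
    and "x \<in> carrier M \<Longrightarrow> y \<in> carrier M \<Longrightarrow> (N +>\<^bsub>M\<^esub> x) \<oplus>\<^bsub>quotient_module M N\<^esub> (N +>\<^bsub>M\<^esub> y) = N +>\<^bsub>M\<^esub> (x \<oplus>\<^bsub>M\<^esub> y)"
    and "x \<in> carrier M \<Longrightarrow> a \<in> carrier K \<Longrightarrow> a \<odot>\<^bsub>quotient_module M N\<^esub> (N +>\<^bsub>M\<^esub> x) = N +>\<^bsub>M\<^esub> (a \<odot>\<^bsub>M\<^esub> x)"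
proof -
  interpret V: vectorspace K M by fact
  interpret S: submodule K N M by fact
  have neg: "inv\<^bsub>add_monoid M\<^esub> a \<in> N" if "a \<in> N" for a
    using S.smult_closed[OF V.R.a_inv_closed[OF V.R.one_closed] that] V.smult_minus_1[of a] S.subset that
    unfolding a_inv_def by (metis subsetD)
  have sg: "subgroup N (add_monoid M)"
    by (rule subgroup.intro) (use S.subset S.zero_closed S.m_closed neg in auto)
  interpret A: abelian_subgroup N M
    by (rule abelian_subgroupI3[OF additive_subgroupI[OF sg] V.M.abelian_group_axioms])
  show car: "carrier (quotient_module M N) = (\<lambda>x. N +>\<^bsub>M\<^esub> x) ` carrier M"
    by (auto simp: quotient_module_def A_RCOSETS_def' a_r_coset_def')
  show add: "(N +>\<^bsub>M\<^esub> x) \<oplus>\<^bsub>quotient_module M N\<^esub> (N +>\<^bsub>M\<^esub> y) = N +>\<^bsub>M\<^esub> (x \<oplus>\<^bsub>M\<^esub> y)"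
    if "x \<in> carrier M" "y \<in> carrier M" for x y
    using A.a_rcos_sum that by (simp add: quotient_module_def)
  show smul: "a \<odot>\<^bsub>quotient_module M N\<^esub> (N +>\<^bsub>M\<^esub> x) = N +>\<^bsub>M\<^esub> (a \<odot>\<^bsub>M\<^esub> x)"
    if x: "x \<in> carrier M" and a: "a \<in> carrier K" for x a
  proof -
    have "N +>\<^bsub>M\<^esub> (a \<odot>\<^bsub>M\<^esub> y) = N +>\<^bsub>M\<^esub> (a \<odot>\<^bsub>M\<^esub> x)" if y: "y \<in> N +>\<^bsub>M\<^esub> x" for y
    proof -
      obtain n where n: "n \<in> N" "y = n \<oplus>\<^bsub>M\<^esub> x" using y by (auto simp: a_r_coset_def')
      then have "a \<odot>\<^bsub>M\<^esub> y = (a \<odot>\<^bsub>M\<^esub> n) \<oplus>\<^bsub>M\<^esub> (a \<odot>\<^bsub>M\<^esub> x)"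
        using V.smult_r_distr[OF a] x S.subset by auto
      then have "a \<odot>\<^bsub>M\<^esub> y \<in> N +>\<^bsub>M\<^esub> (a \<odot>\<^bsub>M\<^esub> x)"
        using S.smult_closed[OF a n(1)] by (auto simp: a_r_coset_def')
      from A.a_repr_independence'[OF this V.smult_closed[OF a x]] show ?thesis by (rule sym)
    qed
    moreover have "x \<in> N +>\<^bsub>M\<^esub> x" using A.a_rcos_self[OF x] .
    ultimately have "(\<Union>y\<in>N +>\<^bsub>M\<^esub> x. N +>\<^bsub>M\<^esub> (a \<odot>\<^bsub>M\<^esub> y)) = N +>\<^bsub>M\<^esub> (a \<odot>\<^bsub>M\<^esub> x)"
      by (metis (no_types, lifting) SUP_eq_const empty_iff)
    then show ?thesis by (simp add: quotient_module_def)
  qed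
  have zero: "\<zero>\<^bsub>quotient_module M N\<^esub> = N +>\<^bsub>M\<^esub> \<zero>\<^bsub>M\<^esub>"
    using V.M.a_coset_add_zero[OF S.subset] by (simp add: quotient_module_def)
  have "abelian_group (quotient_module M N)"
  proof (rule abelian_groupI)
    fix A assume "A \<in> carrier (quotient_module M N)"
    then obtain x where x: "x \<in> carrier M" "A = N +>\<^bsub>M\<^esub> x" by (auto simp: car)
    then have "(N +>\<^bsub>M\<^esub> (\<ominus>\<^bsub>M\<^esub> x)) \<oplus>\<^bsub>quotient_module M N\<^esub> A = \<zero>\<^bsub>quotient_module M N\<^esub>"
      by (simp add: add zero V.M.l_neg)
    then show "\<exists>B\<in>carrier (quotient_module M N). B \<oplus>\<^bsub>quotient_module M N\<^esub> A = \<zero>\<^bsub>quotient_module M N\<^esub>"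
      using x(1) unfolding car by blast
  qed (auto simp: car add zero V.M.add.m_ac)
  then have "module K (quotient_module M N)"
    by (intro moduleI[OF V.cring_axioms])
       (simp_all add: car image_iff, auto simp: add smul V.smult_r_distr V.smult_l_distr V.smult_assoc1)
  then show "vectorspace K (quotient_module M N)"
    by (simp add: vectorspace_def V.field_axioms)
qed


lemma boundaries_submodule:
  assumes "finite_complex \<K>"
  shows "submodule class_ring (boundaries \<K> k) (cycle_space \<K> k :: ('f::field, 'a list \<Rightarrow> 'f) module)"
proof -
  interpret vectorspace class_ring "cycle_space \<K> k :: ('f::field, 'a list \<Rightarrow> 'f) module"
    by (rule cycle_space_vectorspace)
  let ?B = "boundaries \<K> k :: ('a list \<Rightarrow> 'f) set"
  have "(\<lambda>_. 0) \<in> ?B"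
    unfolding boundaries_def by (rule image_eqI, rule boundary_lin(1)[symmetric], rule chains_lin(1))
  moreover have "(\<lambda>xs. c xs + d xs) \<in> ?B" if cd: "c \<in> ?B" "d \<in> ?B" for c d
  proof -
    obtain c' d' where c': "c' \<in> oriented_chains \<K> (Suc k)" "c = boundary \<K> (Suc k) c'"
      "d' \<in> oriented_chains \<K> (Suc k)" "d = boundary \<K> (Suc k) d'"
      using cd unfolding boundaries_def by blast
    show ?thesis unfolding boundaries_def c'(2,4)
      by (rule image_eqI, rule boundary_lin(2)[symmetric], rule chains_lin(2)[OF c'(1,3)])
  qed
  moreover have "(\<lambda>xs. a * c xs) \<in> ?B" if cd: "c \<in> ?B" for c a
  proof -
    obtain c' where c': "c' \<in> oriented_chains \<K> (Suc k)" "c = boundary \<K> (Suc k) c'"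
      using cd unfolding boundaries_def by blast
    show ?thesis unfolding boundaries_def c'(2)
      by (rule image_eqI, rule boundary_lin(3)[symmetric], rule chains_lin(3)[OF c'(1)])
  qed
  ultimately show ?thesis
    using module_axioms
    by (intro submodule.intro)
       (auto simp: cycle_space_def intro: subsetD[OF finite_complex.boundaries_cycles[OF assms]])
qed

lemma homology_vectorspace:
  assumes "finite_complex \<K>"
  shows "vectorspace class_ring (homology \<K> k :: ('f::field, ('a list \<Rightarrow> 'f) set) module)"
  unfolding homology_def
  by (rule quotient_vectorspace[OF cycle_space_vectorspace boundaries_submodule[OF assms]])

lemma coset_eq: "boundaries \<K> k +>\<^bsub>cycle_space \<L> k\<^esub> c = {\<lambda>xs. b xs + c xs | b. b \<in> boundaries \<K> k}"
  by (auto simp: a_r_coset_def' cycle_space_def)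

lemma boundaries_mono:
  assumes "finite_complex \<L>" "\<K> \<subseteq> \<L>"
  shows "boundaries \<K> k \<subseteq> boundaries \<L> k"
  unfolding boundaries_def using boundary_mono[OF assms] by (metis image_subsetI image_eqI)

lemma cycles_mono:
  assumes "finite_complex \<L>" "\<K> \<subseteq> \<L>"
  shows "cycles \<K> k \<subseteq> cycles \<L> k"
  unfolding cycles_def using boundary_mono[OF assms] by fastforce

lemma homology_inclusion_coset:
  assumes L: "finite_complex \<L>" "\<K> \<subseteq> \<L>" and K: "finite_complex \<K>"
  shows "homology_inclusion \<L> k (boundaries \<K> k +>\<^bsub>cycle_space \<K> k\<^esub> c)
    = boundaries \<L> k +>\<^bsub>cycle_space \<L> k\<^esub> (c :: 'a list \<Rightarrow> 'f::field)"
proof -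
  let ?B = "boundaries \<L> k :: ('a list \<Rightarrow> 'f) set"
  interpret S: submodule class_ring ?B "cycle_space \<L> k" by (rule boundaries_submodule[OF L(1)])
  have add: "(\<lambda>xs. b xs + d xs) \<in> ?B" if "b \<in> ?B" "d \<in> ?B" for b d
    using S.m_closed[OF that] by (simp add: cycle_space_def)
  have neg: "(\<lambda>xs. - b xs) \<in> ?B" if "b \<in> ?B" for b
    using S.smult_closed[OF _ that, of "-1"] by (simp add: cycle_space_def)
  have zero: "(\<lambda>_. 0) \<in> boundaries \<K> k"
    using submodule.zero_closed[OF boundaries_submodule[OF K]] by (simp add: cycle_space_def)
  have *: "boundaries \<L> k +>\<^bsub>cycle_space \<L> k\<^esub> (\<lambda>xs. b xs + c xs) = boundaries \<L> k +>\<^bsub>cycle_space \<L> k\<^esub> c"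
    if "b \<in> boundaries \<K> k" for b
  proof -
    have b: "b \<in> ?B" using boundaries_mono[OF L] that by blast
    show ?thesis unfolding coset_eq
    proof (intro equalityI subsetI)
      fix x assume "x \<in> {\<lambda>xs. d xs + (b xs + c xs) |d. d \<in> ?B}"
      then obtain d where "d \<in> ?B" "x = (\<lambda>xs. d xs + (b xs + c xs))" by blast
      then show "x \<in> {\<lambda>xs. d xs + c xs |d. d \<in> ?B}"
        using add[of d b] b by (auto simp: add.assoc intro!: exI[of _ "\<lambda>xs. d xs + b xs"])
    next
      fix x assume "x \<in> {\<lambda>xs. d xs + c xs |d. d \<in> ?B}"
      then obtain d where "d \<in> ?B" "x = (\<lambda>xs. d xs + c xs)" by blast
      then show "x \<in> {\<lambda>xs. d xs + (b xs + c xs) |d. d \<in> ?B}"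
        using add[of d "\<lambda>xs. - b xs"] neg[OF b] by (auto intro!: exI[of _ "\<lambda>xs. d xs + - b xs"])
    qed
  qed
  have "homology_inclusion \<L> k (boundaries \<K> k +>\<^bsub>cycle_space \<K> k\<^esub> c)
     = (\<Union>b\<in>boundaries \<K> k. boundaries \<L> k +>\<^bsub>cycle_space \<L> k\<^esub> (\<lambda>xs. b xs + c xs))"
    unfolding homology_inclusion_def coset_eq[of \<K> k \<K>] by blast
  then show ?thesis using * zero by auto
qed

lemma homology_carrier:
  assumes "finite_complex \<K>"
  shows "carrier (homology \<K> k :: ('f::field, ('a list \<Rightarrow> 'f) set) module) = (\<lambda>c. boundaries \<K> k +>\<^bsub>cycle_space \<K> k\<^esub> c) ` cycles \<K> k"
  unfolding homology_def quotient_vectorspace(2)[OF cycle_space_vectorspace boundaries_submodule[OF assms]]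
  by (simp add: cycle_space_def)

lemma homology_inclusion_linear:
  assumes L: "finite_complex \<L>" "\<K> \<subseteq> \<L>" and K: "finite_complex \<K>"
  shows "linear_map class_ring (homology \<K> k :: ('f::field, ('a list \<Rightarrow> 'f) set) module) (homology \<L> k)
    (homology_inclusion \<L> k)"
proof -
  note Q = quotient_vectorspace(3,4)[OF cycle_space_vectorspace boundaries_submodule, folded homology_def]
  have VK: "vectorspace class_ring (homology \<K> k :: ('f, ('a list \<Rightarrow> 'f) set) module)"
    and VL: "vectorspace class_ring (homology \<L> k :: ('f, ('a list \<Rightarrow> 'f) set) module)"
    using homology_vectorspace K L(1) by blast+
  have car: "cycles \<K> k \<subseteq> carrier (cycle_space \<K> k :: ('f, 'a list \<Rightarrow> 'f) module)" "cycles \<K> k \<subseteq> carrier (cycle_space \<L> k :: ('f, 'a list \<Rightarrow> 'f) module)"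
    using subsetD[OF cycles_mono[OF L]] by (auto simp: cycle_space_def)
  have ops: "add (cycle_space \<K> k :: ('f, 'a list \<Rightarrow> 'f) module) = add (cycle_space \<L> k)"
    "module.smult (cycle_space \<K> k :: ('f, 'a list \<Rightarrow> 'f) module) = module.smult (cycle_space \<L> k)"
    by (auto simp: cycle_space_def)
  have "homology_inclusion \<L> k \<in> module_hom class_ring (homology \<K> k :: ('f, ('a list \<Rightarrow> 'f) set) module) (homology \<L> k)"
    unfolding module_hom_def homology_carrier[OF K] homology_carrier[OF L(1)]
  proof (intro CollectI conjI allI impI)
    show "homology_inclusion \<L> k \<in> (+>\<^bsub>cycle_space \<K> k\<^esub>) (boundaries \<K> k) ` cycles \<K> k
      \<rightarrow> (+>\<^bsub>cycle_space \<L> k\<^esub>) (boundaries \<L> k) ` (cycles \<L> k :: ('a list \<Rightarrow> 'f) set)"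
      by (auto simp: homology_inclusion_coset[OF assms] intro!: imageI subsetD[OF cycles_mono[OF L]])
  next
    fix A B :: "('a list \<Rightarrow> 'f) set"
    assume "A \<in> (+>\<^bsub>cycle_space \<K> k\<^esub>) (boundaries \<K> k) ` cycles \<K> k \<and> B \<in> (+>\<^bsub>cycle_space \<K> k\<^esub>) (boundaries \<K> k) ` cycles \<K> k"
    then obtain c d where cd: "c \<in> cycles \<K> k" "A = boundaries \<K> k +>\<^bsub>cycle_space \<K> k\<^esub> c"
      "d \<in> cycles \<K> k" "B = boundaries \<K> k +>\<^bsub>cycle_space \<K> k\<^esub> d" by blast
    show "homology_inclusion \<L> k (A \<oplus>\<^bsub>homology \<K> k\<^esub> B) = homology_inclusion \<L> k A \<oplus>\<^bsub>homology \<L> k\<^esub> homology_inclusion \<L> k B"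
      using car cd by (simp add: Q(1)[OF K] Q(1)[OF L(1)] homology_inclusion_coset[OF assms] ops subset_iff)
  next
    fix a :: 'f and A :: "('a list \<Rightarrow> 'f) set"
    assume "a \<in> carrier class_ring \<and> A \<in> (+>\<^bsub>cycle_space \<K> k\<^esub>) (boundaries \<K> k) ` cycles \<K> k"
    then obtain c where cd: "c \<in> cycles \<K> k" "A = boundaries \<K> k +>\<^bsub>cycle_space \<K> k\<^esub> c" by blast
    show "homology_inclusion \<L> k (a \<odot>\<^bsub>homology \<K> k\<^esub> A) = a \<odot>\<^bsub>homology \<L> k\<^esub> homology_inclusion \<L> k A"
      using car cd by (simp add: Q(2)[OF K] Q(2)[OF L(1)] homology_inclusion_coset[OF assms] ops subset_iff)
  qed
  then show ?thesis
    using VK VL by (simp add: linear_map_def mod_hom_def mod_hom_axioms_def vectorspace_def)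
qed

lemma vietoris_rips_complex:
  assumes "finite X"
  shows "finite_complex (vietoris_rips X d \<delta>)"
proof
  show "finite (\<Union>(vietoris_rips X d \<delta>))"
    by (rule finite_subset[OF _ assms]) (auto simp: vietoris_rips_def)
  fix \<sigma> \<tau> assume s: "\<sigma> \<in> vietoris_rips X d \<delta>" "\<tau> \<subseteq> \<sigma>" "\<tau> \<noteq> {}"
  then have "finite \<sigma>" using assms finite_subset by (auto simp: vietoris_rips_def)
  then have "diam d \<tau> \<le> diam d \<sigma>"
    unfolding diam_def using s by (intro Max_mono) auto
  then show "\<tau> \<in> vietoris_rips X d \<delta>" using s by (auto simp: vietoris_rips_def)
qed

lemma vietoris_rips_mono: "\<delta> \<le> \<delta>' \<Longrightarrow> vietoris_rips X d \<delta> \<subseteq> vietoris_rips X d \<delta>'"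
  by (auto simp: vietoris_rips_def)

lemma vietoris_rips_homology_persistence:
  assumes "finite X"
  shows "persistence_vector_space class_ring
    (vietoris_rips_homology k X d :: ('f::field, ('a list \<Rightarrow> 'f) set) persistence)"
proof (rule persistence_vector_space.intro)
  note C = vietoris_rips_complex[OF assms]
  let ?V = "vietoris_rips_homology k X d :: ('f, ('a list \<Rightarrow> 'f) set) persistence"
  show "linear_map class_ring (pspace ?V s) (pspace ?V t) (pmap ?V s t)" if "s \<le> t" for s t
    using homology_inclusion_linear[OF C vietoris_rips_mono[OF that] C] by (simp add: vietoris_rips_homology_def)
  show "pmap ?V s s x = x" if "x \<in> carrier (pspace ?V s)" for s x
    using that
    by (auto simp: vietoris_rips_homology_def homology_carrier[OF C] homology_inclusion_coset[OF C order_refl C])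
  show "pmap ?V s u x = pmap ?V t u (pmap ?V s t x)"
    if le: "s \<le> t" "t \<le> u" and x: "x \<in> carrier (pspace ?V s)" for s t u x
    using x
    by (auto simp: vietoris_rips_homology_def homology_carrier[OF C]
        homology_inclusion_coset[OF C vietoris_rips_mono[OF le(1)] C]
        homology_inclusion_coset[OF C vietoris_rips_mono[OF le(2)] C]
        homology_inclusion_coset[OF C vietoris_rips_mono[OF order_trans[OF le]] C])
qed

end

theory Submission
  imports Defs
begin

text \<open>
  An \<open>\<eta>\<close>-isometry \<open>(\<phi>, \<psi>)\<close> consists of simplicial maps from the complexes at scale \<open>s\<close> to those at
  scale \<open>s + \<eta>\<close>, and at scale \<open>s + 2 * \<eta>\<close> the composites \<open>\<psi> \<circ> \<phi>\<close> and \<open>\<phi> \<circ> \<psi>\<close> are contiguous to the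
  inclusions, so that \<open>\<phi>\<close> and \<open>\<psi>\<close> induce an \<open>\<eta>\<close>-interleaving in homology.

  Contiguous maps induce the same map in homology: it is enough to change the value at a single
  vertex \<open>v\<close>, from \<open>a\<close> to \<open>b\<close>, and then $c \mapsto a \wedge b \wedge f_*(\iota_v c)$ is a chain homotopy,
  where $\iota_v c$ is the contraction $xs \mapsto c(v, xs)$. Unlike the usual prism operator, it
  needs no ordering of the vertices. On alternating functions of lists the boundary operator is
  the sum of the contractions by all vertices, and the identities needed follow by recursion on
  the list from the behaviour of the operators under contraction.
\<close>

section \<open>Adjacent transpositions\<close>

text \<open>The local form of the sign rule survives fixing the first entry, which suits recursion
  on lists. Vanishing on equal neighbours is a clause of its own because in characteristic 2 the
  sign rule does not imply it.\<close>

definition adj_alternating :: "('a list \<Rightarrow> 'f::field) \<Rightarrow> bool" where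
  "adj_alternating c \<longleftrightarrow>
    (\<forall>us u v vs. c (us @ v # u # vs) = - c (us @ u # v # vs)) \<and> (\<forall>us u vs. c (us @ u # u # vs) = 0)"

lemma adj_alternatingI:
  assumes "\<And>us u v vs. c (us @ v # u # vs) = - c (us @ u # v # vs)" "\<And>us u vs. c (us @ u # u # vs) = 0"
  shows "adj_alternating c"
  using assms unfolding adj_alternating_def by blast

lemma adj_swap: "adj_alternating c \<Longrightarrow> c (us @ v # u # vs) = - c (us @ u # v # vs)"
  and adj_eq: "adj_alternating c \<Longrightarrow> c (us @ u # u # vs) = 0"
  unfolding adj_alternating_def by blast+

lemma adj_swap_Cons: "adj_alternating c \<Longrightarrow> c (v # u # vs) = - c (u # v # vs)"
  and adj_eq_Cons: "adj_alternating c \<Longrightarrow> c (u # u # vs) = 0"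
  using adj_swap[of c "[]" v u vs] adj_eq[of c "[]" u vs] by simp_all

lemma adj_alternating_contract:
  assumes "adj_alternating c" shows "adj_alternating (\<lambda>xs. c (v # xs))"
proof (rule adj_alternatingI)
  show "c (v # us @ y # x # vs) = - c (v # us @ x # y # vs)" for us x y vs
    using adj_swap[OF assms, of "v # us" y x vs] by simp
  show "c (v # us @ x # x # vs) = 0" for us x vs
    using adj_eq[OF assms, of "v # us" x vs] by simp
qed

lemma adj_move:
  assumes "adj_alternating c"
  shows "c (us @ ms @ v # vs) = (-1) ^ length ms * c (us @ v # ms @ vs)"
proof (induction ms arbitrary: vs rule: rev_induct)
  case (snoc m ms)
  have "c (us @ (ms @ [m]) @ v # vs) = - c (us @ ms @ v # m # vs)"
    using adj_swap[OF assms, of "us @ ms" m v vs] by simp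
  also have "\<dots> = - ((-1) ^ length ms * c (us @ v # ms @ m # vs))"
    by (simp add: snoc)
  finally show ?case by simp
qed simp

text \<open>Moving \<open>u\<close> left and \<open>v\<close> right past \<open>ms\<close> costs the
  same sign twice, so the only sign left is that of one adjacent swap.\<close>

lemma adj_exchange:
  assumes "adj_alternating c"
  shows "c (us @ v # ms @ u # vs) = - c (us @ u # ms @ v # vs)"
proof -
  have "c (us @ v # ms @ u # vs) = (-1) ^ length ms * c (us @ v # u # ms @ vs)"
    using adj_move[OF assms, of "us @ [v]" ms u vs] by simp
  also have "\<dots> = - ((-1) ^ length ms * c (us @ u # v # ms @ vs))"
    using adj_swap[OF assms, of us v u "ms @ vs"] by simp
  also have "\<dots> = - c (us @ u # ms @ v # vs)"
    using adj_move[OF assms, of "us @ [u]" ms v vs] by simp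
  finally show ?thesis .
qed

text \<open>Two equal entries can be brought side by side at the cost of a sign, where the second
  clause of \<open>adj_alternating\<close> applies in every characteristic.\<close>

lemma adj_nondistinct:
  assumes "adj_alternating c" "\<not> distinct xs"
  shows "c xs = 0"
proof -
  obtain us u ms vs where xs: "xs = us @ [u] @ ms @ [u] @ vs"
    using not_distinct_decomp[OF assms(2)] by blast
  show ?thesis
    using adj_move[OF assms(1), of "us @ [u]" ms u vs] adj_eq[OF assms(1), of us u "ms @ vs"]
    by (simp add: xs)
qed

lemma adj_transpose:
  assumes "adj_alternating c" "a < b" "b < length xs"
  shows "c (permute_list (Transposition.transpose a b) xs) = - c xs"
proof -
  let ?us = "take a xs" and ?ms = "drop (Suc a) (take b xs)" and ?vs = "drop (Suc b) xs"
  have xs: "xs = ?us @ xs ! a # ?ms @ xs ! b # ?vs"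
  proof -
    have "xs = take b xs @ xs ! b # ?vs" by (rule id_take_nth_drop[OF assms(3)])
    also have "take b xs = ?us @ xs ! a # ?ms"
      using assms(2,3) by (intro trans[OF id_take_nth_drop[of a "take b xs"]]) simp_all
    finally show ?thesis unfolding append_assoc append_Cons .
  qed
  have "permute_list (Transposition.transpose a b) xs = ?us @ xs ! b # ?ms @ xs ! a # ?vs"
  proof (rule nth_equalityI)
    show "length (permute_list (Transposition.transpose a b) xs) = length (?us @ xs ! b # ?ms @ xs ! a # ?vs)"
      using assms(2,3) by simp
    fix i assume "i < length (permute_list (Transposition.transpose a b) xs)"
    then have i: "i < length xs" by simp
    then have "permute_list (Transposition.transpose a b) xs ! i = xs ! Transposition.transpose a b i"
      by (simp add: permute_list_def)
    also have "\<dots> = (?us @ xs ! b # ?ms @ xs ! a # ?vs) ! i"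
      using assms(2,3) i
      by (auto simp: nth_append nth_Cons' Transposition.transpose_def)
    finally show "permute_list (Transposition.transpose a b) xs ! i = (?us @ xs ! b # ?ms @ xs ! a # ?vs) ! i" .
  qed
  then show ?thesis
    using adj_exchange[OF assms(1), of ?us "xs ! b" ?ms "xs ! a" ?vs] by (simp only: xs[symmetric])
qed

text \<open>Induction along a factorisation of the permutation into transpositions, each of which
  changes the sign on both sides.\<close>

lemma adj_imp_alternating:
  assumes "adj_alternating c" shows "alternating c"
  unfolding alternating_def
proof (intro allI impI)
  fix xs :: "'a list" and p assume "p permutes {..<length xs}"
  with finite_lessThan show "c (permute_list p xs) = of_int (sign p) * c xs"
  proof (induction p rule: permutes_rev_induct)
    case (swap a b p)
    let ?t = "Transposition.transpose a b"
    have t: "?t permutes {..<length xs}"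
      using swap by (intro permutes_swap_id)
    \<comment> \<open>Composing with \<open>?t\<close> on the right acts on the list already
      permuted by \<open>p\<close>. Since \<open>adj_transpose\<close> takes its positions in
      increasing order, the other order is reduced to it by symmetry of the transposition.\<close>
    have "c (permute_list ?t (permute_list p xs)) = - c (permute_list p xs)"
    proof (cases "a < b")
      case False
      then have "b < a" using swap by simp
      then show ?thesis
        using adj_transpose[OF assms, of b a] swap by (simp add: Transposition.transpose_commute)
    qed (use adj_transpose[OF assms] swap in simp)
    moreover have "sign (p \<circ> ?t) = - sign p"
      using swap sign_compose[of p ?t] permutation_swap_id[of a b] permutes_imp_permutation[of "{..<length xs}" p]
      by (simp add: sign_swap_id)
    ultimately show ?case
      using swap permute_list_compose[OF t, of p] by (simp only: of_int_minus mult_minus_left)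
  qed (simp add: sign_id)
qed

text \<open>Distinctness on the support is recovered from \<open>adj_nondistinct\<close>, so
  supports can be tracked by length and vertex set alone.\<close>

lemma chains_iff_adj:
  "c \<in> oriented_chains \<K> k \<longleftrightarrow>
    adj_alternating c \<and> (\<forall>xs. c xs \<noteq> 0 \<longrightarrow> length xs = Suc k \<and> set xs \<in> \<K>)"
proof
  assume c: "c \<in> oriented_chains \<K> k"
  have "adj_alternating c"
  proof (rule adj_alternatingI)
    show "c (us @ v # u # vs) = - c (us @ u # v # vs)" for us u v vs
      by (rule alt_adjacent[OF chains_alt[OF c]])
    show "c (us @ u # u # vs) = 0" for us u vs
      using c by (auto simp: oriented_chains_def ordered_simplices_def)
  qed
  then show "adj_alternating c \<and> (\<forall>xs. c xs \<noteq> 0 \<longrightarrow> length xs = Suc k \<and> set xs \<in> \<K>)"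
    using c by (auto simp: oriented_chains_def ordered_simplices_def)
next
  assume "adj_alternating c \<and> (\<forall>xs. c xs \<noteq> 0 \<longrightarrow> length xs = Suc k \<and> set xs \<in> \<K>)"
  then show "c \<in> oriented_chains \<K> k"
    using adj_nondistinct adj_imp_alternating unfolding chains_iff ordered_simplices_def by blast
qed

section \<open>Exterior multiplication by a vertex\<close>

text \<open>The exterior product of \<open>a\<close> and \<open>c\<close>: unfolded, the alternating
  sum, over the positions where \<open>a\<close> stands, of \<open>c\<close> on the list with that
  entry removed. The recursion says that contraction is an antiderivation.\<close>

primrec wedge :: "'a \<Rightarrow> ('a list \<Rightarrow> 'f::field) \<Rightarrow> 'a list \<Rightarrow> 'f" where
  "wedge a c [] = 0"
| "wedge a c (y # ys) = (if y = a then c ys else 0) - wedge a (\<lambda>xs. c (y # xs)) ys"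

lemma wedge_zero: "wedge a (\<lambda>_. 0) ys = 0"
  by (induction ys) auto

lemma wedge_uminus: "wedge a (\<lambda>xs. - c xs) ys = - wedge a c ys"
  by (induction ys arbitrary: c) auto

lemma wedge_add: "wedge a (\<lambda>xs. c xs + d xs) ys = wedge a c ys + wedge a d ys"
  by (induction ys arbitrary: c d) auto

lemma wedge_sum: "finite V \<Longrightarrow> wedge a (\<lambda>xs. \<Sum>v\<in>V. c v xs) ys = (\<Sum>v\<in>V. wedge a (c v) ys)"
  by (induction V rule: finite_induct) (auto simp: wedge_zero wedge_add)

text \<open>At the swapped pair the two Kronecker terms of the recursion trade places with opposite
  signs (for equal entries they cancel). In the remaining term \<open>c\<close> is contracted by
  both entries and contributes its own sign.\<close>

lemma wedge_adj_alternating: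
  assumes "adj_alternating c" shows "adj_alternating (wedge a c)"
proof (rule adj_alternatingI)
  show "wedge a c (us @ v # u # vs) = - wedge a c (us @ u # v # vs)" for us u v vs
    using assms
  proof (induction us arbitrary: c)
    case Nil
    then have "c (v # u # xs) = - c (u # v # xs)" for xs by (rule adj_swap_Cons)
    then show ?case by (simp add: wedge_uminus)
  next
    case (Cons x us)
    have "c (us @ v # u # vs) = - c (us @ u # v # vs)" by (rule adj_swap[OF Cons.prems])
    then show ?case using Cons.IH[OF adj_alternating_contract[OF Cons.prems]] by simp
  qed
  show "wedge a c (us @ u # u # vs) = 0" for us u vs
    using assms
  proof (induction us arbitrary: c)
    case Nil
    then have "c (u # u # xs) = 0" for xs by (rule adj_eq_Cons)
    then show ?case by (simp add: wedge_zero)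
  next
    case (Cons x us)
    have "c (us @ u # u # vs) = 0" by (rule adj_eq[OF Cons.prems])
    then show ?case using Cons.IH[OF adj_alternating_contract[OF Cons.prems]] by simp
  qed
qed

text \<open>Some term of the alternating sum must be nonzero. This later locates the homotopy chain
  inside the target complex.\<close>

lemma wedge_support:
  assumes "wedge a c ys \<noteq> 0"
  shows "\<exists>xs. c xs \<noteq> 0 \<and> length ys = Suc (length xs) \<and> set ys = insert a (set xs)"
  using assms
proof (induction ys arbitrary: c)
  case (Cons y ys)
  show ?case
  proof (cases "y = a \<and> c ys \<noteq> 0")
    case True
    then show ?thesis by (intro exI[of _ ys]) simp
  next
    case False
    then have "wedge a (\<lambda>xs. c (y # xs)) ys \<noteq> 0" using Cons.prems by (auto split: if_splits)
    from Cons.IH[OF this] obtain xs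
      where "c (y # xs) \<noteq> 0" "length ys = Suc (length xs)" "set ys = insert a (set xs)" by blast
    then show ?thesis by (intro exI[of _ "y # xs"]) (simp add: insert_commute)
  qed
qed simp

text \<open>Summing the recursion of \<open>wedge\<close> over the first entry gives the Leibniz
  rule for the boundary; by \<open>a \<in> V\<close> the Kronecker term occurs exactly once.\<close>

lemma boundary_wedge:
  assumes "finite V" "a \<in> V"
  shows "(\<Sum>v\<in>V. wedge a c (v # ys)) = c ys - wedge a (\<lambda>xs. \<Sum>v\<in>V. c (v # xs)) ys"
  using assms by (simp add: wedge_sum sum_subtractf)

section \<open>Pushforward of chains\<close>

text \<open>Unfolded, this sums \<open>c\<close> over all lifts of the list along \<open>f\<close>,
  which is the usual induced chain map. Contributions of simplices collapsed by \<open>f\<close>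
  cancel by alternation.\<close>

primrec pushforward :: "'a set \<Rightarrow> ('a \<Rightarrow> 'b) \<Rightarrow> ('a list \<Rightarrow> 'f::field) \<Rightarrow> 'b list \<Rightarrow> 'f" where
  "pushforward V f c [] = c []"
| "pushforward V f c (y # ys) = (\<Sum>v\<in>V. if f v = y then pushforward V f (\<lambda>xs. c (v # xs)) ys else 0)"

lemma pushforward_zero: "pushforward V f (\<lambda>_. 0) = (\<lambda>_. 0)"
proof
  show "pushforward V f (\<lambda>_. 0) ys = 0" for ys by (induction ys) auto
qed

lemma pushforward_add:
  "pushforward V f (\<lambda>xs. c xs + d xs) = (\<lambda>ys. pushforward V f c ys + pushforward V f d ys)"
proof
  fix ys
  show "pushforward V f (\<lambda>xs. c xs + d xs) ys = pushforward V f c ys + pushforward V f d ys"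
  proof (induction ys arbitrary: c d)
    case (Cons y ys)
    have "(if f v = y then pushforward V f (\<lambda>xs. c (v # xs) + d (v # xs)) ys else 0)
        = (if f v = y then pushforward V f (\<lambda>xs. c (v # xs)) ys else 0)
          + (if f v = y then pushforward V f (\<lambda>xs. d (v # xs)) ys else 0)" for v
      using Cons.IH[of "\<lambda>xs. c (v # xs)" "\<lambda>xs. d (v # xs)"] by simp
    then show ?case by (simp add: sum.distrib)
  qed simp
qed

lemma pushforward_scale: "pushforward V f (\<lambda>xs. a * c xs) = (\<lambda>ys. a * pushforward V f c ys)"
proof
  fix ys
  show "pushforward V f (\<lambda>xs. a * c xs) ys = a * pushforward V f c ys"
  proof (induction ys arbitrary: c)
    case (Cons y ys)
    have "(if f v = y then pushforward V f (\<lambda>xs. a * c (v # xs)) ys else 0)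
        = a * (if f v = y then pushforward V f (\<lambda>xs. c (v # xs)) ys else 0)" for v
      using Cons.IH[of "\<lambda>xs. c (v # xs)"] by simp
    then show ?case by (simp add: sum_distrib_left)
  qed simp
qed

lemma pushforward_uminus: "pushforward V f (\<lambda>xs. - c xs) = (\<lambda>ys. - pushforward V f c ys)"
  using pushforward_scale[of V f "-1" c] by simp

lemma pushforward_sum: "finite U \<Longrightarrow> pushforward V f (\<lambda>xs. \<Sum>u\<in>U. c u xs) ys = (\<Sum>u\<in>U. pushforward V f (c u) ys)"
  by (induction U rule: finite_induct) (auto simp: pushforward_zero pushforward_add)

text \<open>Exchanging two entries exchanges the two sums over their lifts. On a repeated entry the
  double sum is antisymmetric with zero diagonal, hence zero in every characteristic; this is the
  cancellation for collapsed simplices.\<close>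

lemma pushforward_adj_alternating:
  fixes c :: "'a list \<Rightarrow> 'f::field" and f :: "'a \<Rightarrow> 'b"
  assumes "finite V" "adj_alternating c" shows "adj_alternating (pushforward V f c)"
proof (rule adj_alternatingI)
  fix us vs and u v :: 'b
  let ?h = "\<lambda>(c :: 'a list \<Rightarrow> 'f) u v x y. if f x = u \<and> f y = v then pushforward V f (\<lambda>xs. c (x # y # xs)) vs else 0"
  have two: "pushforward V f c (u # v # vs) = (\<Sum>x\<in>V. \<Sum>y\<in>V. ?h c u v x y)" for c u v
    by (auto intro!: sum.cong)
  have h: "?h c u v x y = - ?h c v u y x" "?h c u v x x = 0" if "adj_alternating c" for c u v x y
  proof -
    have "c (x # y # xs) = - c (y # x # xs)" "c (x # x # xs) = 0" for xs
      by (rule adj_swap_Cons[OF that], rule adj_eq_Cons[OF that])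
    then show "?h c u v x y = - ?h c v u y x" "?h c u v x x = 0"
      by (simp_all add: pushforward_uminus pushforward_zero)
  qed
  show "pushforward V f c (us @ v # u # vs) = - pushforward V f c (us @ u # v # vs)"
    using assms(2)
  proof (induction us arbitrary: c)
    case Nil
    have "(\<Sum>x\<in>V. \<Sum>y\<in>V. ?h c v u x y) = (\<Sum>y\<in>V. \<Sum>x\<in>V. - ?h c u v y x)"
      by (subst sum.swap) (intro sum.cong refl h Nil)
    then show ?case unfolding append_Nil two by (simp add: sum_negf)
  next
    case (Cons x us)
    have "(if f w = x then pushforward V f (\<lambda>xs. c (w # xs)) (us @ v # u # vs) else 0)
        = - (if f w = x then pushforward V f (\<lambda>xs. c (w # xs)) (us @ u # v # vs) else 0)" for w
      using Cons.IH[OF adj_alternating_contract[OF Cons.prems, of w]] by simp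
    then show ?case by (simp add: sum_negf)
  qed
  show "pushforward V f c (us @ u # u # vs) = 0"
    using assms(2)
  proof (induction us arbitrary: c)
    case Nil
    show ?case unfolding append_Nil two by (rule double_sum_zero[OF assms(1)]) (intro h Nil)+
  next
    case (Cons x us)
    then show ?case using adj_alternating_contract[OF Cons.prems] by (auto intro!: sum.neutral)
  qed
qed

lemma pushforward_support:
  assumes "pushforward V f c ys \<noteq> 0"
  shows "\<exists>xs. c xs \<noteq> 0 \<and> ys = map f xs"
  using assms
proof (induction ys arbitrary: c)
  case (Cons y ys)
  obtain v where v: "(if f v = y then pushforward V f (\<lambda>xs. c (v # xs)) ys else 0) \<noteq> 0"
    using Cons.prems sum.not_neutral_contains_not_neutral unfolding pushforward.simps(2) by blast
  then have "pushforward V f (\<lambda>xs. c (v # xs)) ys \<noteq> 0" by (simp split: if_splits)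
  from Cons.IH[OF this] obtain xs where "c (v # xs) \<noteq> 0" "ys = map f xs" by blast
  then show ?case using v by (intro exI[of _ "v # xs"]) (simp split: if_splits)
qed auto

text \<open>As the boundary is the sum of all contractions, commuting with it is an exchange of sums
  in which each \<open>v\<close> contributes to exactly one \<open>w\<close>, namely
  \<open>f v\<close>.\<close>

lemma boundary_pushforward:
  assumes "finite V" "finite W" "f \<in> V \<rightarrow> W"
  shows "(\<Sum>w\<in>W. pushforward V f c (w # ys)) = pushforward V f (\<lambda>xs. \<Sum>v\<in>V. c (v # xs)) ys"
proof -
  have "(\<Sum>w\<in>W. pushforward V f c (w # ys))
      = (\<Sum>v\<in>V. \<Sum>w\<in>W. if f v = w then pushforward V f (\<lambda>xs. c (v # xs)) ys else 0)"
    by (subst sum.swap) simp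
  also have "\<dots> = (\<Sum>v\<in>V. pushforward V f (\<lambda>xs. c (v # xs)) ys)"
    using assms by (intro sum.cong) auto
  finally show ?thesis using assms(1) by (simp add: pushforward_sum)
qed

lemma pushforward_comp:
  assumes "finite V" "finite W" "f \<in> V \<rightarrow> W"
  shows "pushforward W g (pushforward V f c) zs = pushforward V (\<lambda>x. g (f x)) c zs"
proof (induction zs arbitrary: c)
  case (Cons z zs)
  let ?h = "\<lambda>w v. if f v = w then pushforward V (\<lambda>x. g (f x)) (\<lambda>xs. c (v # xs)) zs else 0"
  have contract: "pushforward W g (\<lambda>ys. pushforward V f c (w # ys)) zs = (\<Sum>v\<in>V. ?h w v)" for w
  proof -
    have "pushforward W g (\<lambda>ys. pushforward V f c (w # ys)) zs
        = (\<Sum>v\<in>V. pushforward W g (\<lambda>ys. if f v = w then pushforward V f (\<lambda>xs. c (v # xs)) ys else 0) zs)"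
      using assms(1) by (simp add: pushforward_sum)
    also have "\<dots> = (\<Sum>v\<in>V. ?h w v)"
      by (intro sum.cong refl) (simp add: Cons.IH pushforward_zero)
    finally show ?thesis .
  qed
  have "pushforward W g (pushforward V f c) (z # zs) = (\<Sum>w\<in>W. \<Sum>v\<in>V. if g w = z then ?h w v else 0)"
    unfolding pushforward.simps(2)[of W g] by (intro sum.cong refl) (simp add: contract del: pushforward.simps)
  also have "\<dots> = (\<Sum>v\<in>V. \<Sum>w\<in>W. if g w = z then ?h w v else 0)"
    by (rule sum.swap)
  \<comment> \<open>Once \<open>f v = w\<close> is tested first, the sum over \<open>w\<close>
    collapses to the single term at \<open>f v\<close>, which lies in \<open>W\<close>.\<close>
  also have "\<dots> = (\<Sum>v\<in>V. \<Sum>w\<in>W. if f v = w then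
      if g (f v) = z then pushforward V (\<lambda>x. g (f x)) (\<lambda>xs. c (v # xs)) zs else 0 else 0)"
    by (intro sum.cong refl) auto
  also have "\<dots> = pushforward V (\<lambda>x. g (f x)) c (z # zs)"
    unfolding pushforward.simps(2)[of V "\<lambda>x. g (f x)"] using assms by (intro sum.cong refl) auto
  finally show ?case .
qed simp

lemma pushforward_id:
  assumes "finite V" "\<And>xs. c xs \<noteq> 0 \<Longrightarrow> set xs \<subseteq> V"
  shows "pushforward V id c ys = c ys"
proof -
  have "pushforward V id c ys = (if set ys \<subseteq> V then c ys else 0)"
    by (induction ys arbitrary: c) (auto simp: assms(1))
  then show ?thesis using assms(2) by auto
qed

text \<open>Meant for the contraction of an alternating function by \<open>v\<close>, which vanishes
  on every list containing \<open>v\<close>.\<close>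

lemma pushforward_cong:
  assumes "\<And>x. x \<noteq> v \<Longrightarrow> f x = g x" "\<And>xs. v \<in> set xs \<Longrightarrow> c xs = 0"
  shows "pushforward V f c ys = pushforward V g c ys"
  using assms(2)
proof (induction ys arbitrary: c)
  case (Cons y ys)
  have "(if f x = y then pushforward V f (\<lambda>xs. c (x # xs)) ys else 0)
      = (if g x = y then pushforward V g (\<lambda>xs. c (x # xs)) ys else 0)" for x
  proof (cases "x = v")
    case True
    then show ?thesis using Cons.prems by (simp add: pushforward_zero)
  next
    case False
    then show ?thesis using Cons by (simp add: assms(1))
  qed
  then show ?case by simp
qed simp

text \<open>Up to a part avoiding \<open>v\<close>, on which both maps agree, \<open>c\<close> is v
  \<and> \<iota>_v c. The maps also agree on \<iota>_v c, so only the factor \<open>g v\<close> or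
  \<open>f v\<close> in front differs.\<close>

lemma pushforward_change_vertex:
  assumes "finite V" "v \<in> V" "\<And>x. x \<noteq> v \<Longrightarrow> f x = g x" "adj_alternating c"
  shows "pushforward V g c ys - pushforward V f c ys
    = wedge (g v) (pushforward V f (\<lambda>xs. c (v # xs))) ys - wedge (f v) (pushforward V f (\<lambda>xs. c (v # xs))) ys"
  using assms(4)
proof (induction ys arbitrary: c)
  case (Cons y ys)
  let ?E = "\<lambda>x. pushforward V f (\<lambda>xs. c (x # xs)) ys"
  let ?w = "\<lambda>a x. wedge a (pushforward V f (\<lambda>xs. c (v # x # xs))) ys"
  have alt: "c (v # x # xs) = - c (x # v # xs)" "c (v # v # xs) = 0" for x xs
    by (rule adj_swap_Cons[OF Cons.prems], rule adj_eq_Cons[OF Cons.prems])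
  have gE: "pushforward V g (\<lambda>xs. c (v # xs)) ys = ?E v"
  proof (rule pushforward_cong[where v = v])
    show "c (v # xs) = 0" if "v \<in> set xs" for xs
      by (rule adj_nondistinct[OF Cons.prems]) (use that in simp)
  qed (use assms(3) in simp)
  \<comment> \<open>The summand at \<open>v\<close> yields the Kronecker terms of
    \<open>wedge\<close>, its correction vanishing by the repeated \<open>v\<close>. At any other
    \<open>x\<close> the maps agree, and the sign from moving \<open>v\<close> past \<open>x\<close>
    is the minus in the recursion of \<open>wedge\<close>.\<close>
  have *: "(if g x = y then pushforward V g (\<lambda>xs. c (x # xs)) ys else 0) - (if f x = y then ?E x else 0)
      = (if x = v then (if g v = y then ?E v else 0) - (if f v = y then ?E v else 0) else 0)
        - (if f x = y then ?w (g v) x - ?w (f v) x else 0)" for x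
  proof (cases "x = v")
    case True
    then show ?thesis using gE by (simp add: alt(2) pushforward_zero wedge_zero)
  next
    case False
    have "pushforward V g (\<lambda>xs. c (x # xs)) ys - ?E x = - (?w (g v) x - ?w (f v) x)"
      using Cons.IH[OF adj_alternating_contract[OF Cons.prems], of x]
      by (simp add: alt(1)[of x] pushforward_uminus wedge_uminus)
    then show ?thesis using False assms(3)[OF False] by simp
  qed
  have w: "wedge a (\<lambda>xs. pushforward V f (\<lambda>xs. c (v # xs)) (y # xs)) ys
      = (\<Sum>x\<in>V. if f x = y then ?w a x else 0)" for a
    using assms(1) by (auto simp: wedge_sum wedge_zero intro!: sum.cong)
  have "pushforward V g c (y # ys) - pushforward V f c (y # ys)
      = (if g v = y then ?E v else 0) - (if f v = y then ?E v else 0)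
        - (\<Sum>x\<in>V. if f x = y then ?w (g v) x - ?w (f v) x else 0)"
    unfolding pushforward.simps(2) sum_subtractf[symmetric] *
    unfolding sum_subtractf using assms(1,2) by simp
  also have "(\<Sum>x\<in>V. if f x = y then ?w (g v) x - ?w (f v) x else 0)
      = (\<Sum>x\<in>V. if f x = y then ?w (g v) x else 0) - (\<Sum>x\<in>V. if f x = y then ?w (f v) x else 0)"
    by (auto simp flip: sum_subtractf intro!: sum.cong)
  finally show ?case unfolding wedge.simps(2) w by auto
qed simp

lemma pushforward_cong_on:
  assumes "\<And>x. x \<in> V \<Longrightarrow> f x = g x"
  shows "pushforward V f c ys = pushforward V g c ys"
  using assms by (induction ys arbitrary: c) (auto intro!: sum.cong)

section \<open>Simplicial maps and contiguity\<close>

text \<open>\<open>V\<close> and \<open>W\<close> may be larger than the vertex sets, so that one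
  and the same \<open>pushforward V f\<close> serves the complexes at all scales.\<close>

locale simplicial_map = K: finite_complex \<K> + L: finite_complex \<L>
  for V :: "'a set" and \<K> :: "'a set set" and W :: "'b set" and \<L> :: "'b set set" +
  fixes f :: "'a \<Rightarrow> 'b"
  assumes finite_vertices: "finite V" "finite W"
    and vertices: "\<Union>\<K> \<subseteq> V" "\<Union>\<L> \<subseteq> W"
    and map_vertex: "f \<in> V \<rightarrow> W"
    and map_simplex: "\<And>\<sigma>. \<sigma> \<in> \<K> \<Longrightarrow> f ` \<sigma> \<in> \<L>"
begin

lemma pushforward_chain:
  assumes "c \<in> oriented_chains \<K> k"
  shows "pushforward V f c \<in> oriented_chains \<L> k"
  unfolding chains_iff_adj
proof (intro conjI allI impI)
  have c: "adj_alternating c" "\<And>xs. c xs \<noteq> 0 \<Longrightarrow> length xs = Suc k \<and> set xs \<in> \<K>"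
    using assms unfolding chains_iff_adj by blast+
  show "adj_alternating (pushforward V f c)"
    by (rule pushforward_adj_alternating[OF finite_vertices(1) c(1)])
  fix ys assume "pushforward V f c ys \<noteq> 0"
  then obtain xs where "c xs \<noteq> 0" "ys = map f xs" using pushforward_support by blast
  then show "length ys = Suc k" "set ys \<in> \<L>" using c(2)[of xs] map_simplex by auto
qed

lemma pushforward_boundary:
  assumes "c \<in> oriented_chains \<K> k"
  shows "boundary \<L> k (pushforward V f c) = pushforward V f (boundary \<K> k c)"
proof (cases k)
  case 0
  then show ?thesis by (simp add: boundary_def pushforward_zero)
next
  case (Suc n)
  note c = assms[unfolded Suc]
  have "boundary \<K> (Suc n) c = (\<lambda>xs. \<Sum>v\<in>V. c (v # xs))"
    using boundary_eq[OF c finite_vertices(1) vertices(1)] by blast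
  moreover have "boundary \<L> (Suc n) (pushforward V f c) = (\<lambda>ys. \<Sum>w\<in>W. pushforward V f c (w # ys))"
    using boundary_eq[OF pushforward_chain[OF c] finite_vertices(2) vertices(2)] by blast
  ultimately show ?thesis
    using boundary_pushforward[OF finite_vertices map_vertex] Suc by auto
qed

lemma pushforward_cycle:
  assumes "c \<in> cycles \<K> k" shows "pushforward V f c \<in> cycles \<L> k"
  using assms by (auto simp: cycles_def pushforward_chain pushforward_boundary pushforward_zero)

lemma pushforward_boundaries:
  assumes "c \<in> boundaries \<K> k" shows "pushforward V f c \<in> boundaries \<L> k"
proof -
  obtain d where d: "d \<in> oriented_chains \<K> (Suc k)" "c = boundary \<K> (Suc k) d"
    using assms unfolding boundaries_def by blast
  show ?thesis unfolding boundaries_def d(2) pushforward_boundary[OF d(1), symmetric]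
    by (rule imageI) (rule pushforward_chain[OF d(1)])
qed

text \<open>With E = f_*(\<iota>_v c), contractions anticommute, so E has zero boundary because
  \<open>c\<close> is a cycle. Applying the Leibniz rule twice, the boundary of f v \<and> g v
  \<and> E is g v \<and> E - f v \<and> E, the difference found in
  \<open>pushforward_change_vertex\<close>.\<close>

lemma change_vertex_homologous:
  assumes "v \<in> V" "g v \<in> W" "\<And>x. x \<noteq> v \<Longrightarrow> f x = g x"
    and contiguous: "\<And>\<sigma>. \<sigma> \<in> \<K> \<Longrightarrow> f ` \<sigma> \<union> g ` \<sigma> \<in> \<L>"
    and "c \<in> cycles \<K> k"
  shows "(\<lambda>ys. pushforward V g c ys - pushforward V f c ys) \<in> boundaries \<L> k"
proof -
  have "c \<in> oriented_chains \<K> k" and bd: "boundary \<K> k c = (\<lambda>_. 0)"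
    using assms(5) unfolding cycles_def by auto
  then have c: "adj_alternating c" "\<And>xs. c xs \<noteq> 0 \<Longrightarrow> length xs = Suc k \<and> set xs \<in> \<K>"
    unfolding chains_iff_adj by blast+
  define E where "E = pushforward V f (\<lambda>xs. c (v # xs))"
  define d where "d = wedge (f v) (wedge (g v) E)"
  have "adj_alternating E" unfolding E_def
    by (intro pushforward_adj_alternating finite_vertices adj_alternating_contract c(1))
  then have "adj_alternating d" unfolding d_def by (intro wedge_adj_alternating)
  moreover have "length ys = Suc (Suc k) \<and> set ys \<in> \<L>" if nz: "d ys \<noteq> 0" for ys
  proof -
    obtain ys1 where ys1: "wedge (g v) E ys1 \<noteq> 0" "length ys = Suc (length ys1)" "set ys = insert (f v) (set ys1)"
      using wedge_support[OF nz[unfolded d_def]] by blast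
    obtain ys2 where ys2: "E ys2 \<noteq> 0" "length ys1 = Suc (length ys2)" "set ys1 = insert (g v) (set ys2)"
      using wedge_support[OF ys1(1)] by blast
    obtain xs where xs: "c (v # xs) \<noteq> 0" "ys2 = map f xs"
      using pushforward_support[OF ys2(1)[unfolded E_def]] by blast
    \<comment> \<open>Away from \<open>v\<close> the two maps agree, so \<open>g v\<close> is the
      only vertex that \<open>g\<close> can add to the image under \<open>f\<close>.\<close>
    have ys: "set ys = f ` set (v # xs) \<union> g ` set (v # xs)"
      using ys1(3) ys2(3) xs(2) assms(3) by (auto simp: image_iff) (metis+)
    have "set ys \<in> \<L>" unfolding ys using c(2)[OF xs(1)] contiguous by blast
    then show ?thesis using c(2)[OF xs(1)] ys1(2) ys2(2) xs(2) by simp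
  qed
  ultimately have d: "d \<in> oriented_chains \<L> (Suc k)" unfolding chains_iff_adj by blast
  have "(\<Sum>x\<in>V. c (v # x # xs)) = 0" for xs
  proof (cases k)
    \<comment> \<open>In degree 0 the boundary is zero by convention and being a cycle says nothing;
      the sum vanishes because its lists have at least two entries.\<close>
    case 0
    then have "c (v # x # xs) = 0" for x using c(2)[of "v # x # xs"] by auto
    then show ?thesis by simp
  next
    case (Suc n)
    have "(\<Sum>x\<in>V. c (v # x # xs)) = - (\<Sum>x\<in>V. c (x # v # xs))"
      unfolding sum_negf[symmetric] by (intro sum.cong refl adj_swap_Cons[OF c(1)])
    also have "(\<Sum>x\<in>V. c (x # v # xs)) = boundary \<K> (Suc n) c (v # xs)"
      using boundary_eq[OF _ finite_vertices(1) vertices(1)] \<open>c \<in> oriented_chains \<K> k\<close> Suc by metis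
    also have "\<dots> = 0" using bd Suc by simp
    finally show ?thesis by simp
  qed
  then have "(\<Sum>w\<in>W. E (w # ys)) = 0" for ys
    unfolding E_def boundary_pushforward[OF finite_vertices map_vertex] by (simp add: pushforward_zero)
  then have "(\<Sum>w\<in>W. wedge (g v) E (w # ys)) = E ys" for ys
    unfolding boundary_wedge[where a = "g v", OF finite_vertices(2) assms(2)] by (simp add: wedge_zero)
  moreover have "f v \<in> W" using map_vertex assms(1) by blast
  ultimately have "(\<Sum>w\<in>W. d (w # ys)) = wedge (g v) E ys - wedge (f v) E ys" for ys
    unfolding d_def by (simp only: boundary_wedge[OF finite_vertices(2)])
  then have "(\<lambda>ys. pushforward V g c ys - pushforward V f c ys) = boundary \<L> (Suc k) d"
    using pushforward_change_vertex[OF finite_vertices(1) assms(1,3) c(1)]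
      boundary_eq[OF d finite_vertices(2) vertices(2)] by (auto simp: E_def)
  then show ?thesis using d unfolding boundaries_def by blast
qed

end

section \<open>Cosets modulo boundaries\<close>

context finite_complex
begin

lemma boundaries_add: "c \<in> boundaries \<K> k \<Longrightarrow> d \<in> boundaries \<K> k \<Longrightarrow> (\<lambda>xs. c xs + d xs :: 'f::field) \<in> boundaries \<K> k"
  using submodule.m_closed[OF boundaries_submodule[OF finite_complex_axioms]] by (simp add: cycle_space_def)

lemma boundaries_zero: "(\<lambda>_. 0 :: 'f::field) \<in> boundaries \<K> k"
  using submodule.zero_closed[OF boundaries_submodule[OF finite_complex_axioms]] by (simp add: cycle_space_def)

lemma boundaries_uminus: "c \<in> boundaries \<K> k \<Longrightarrow> (\<lambda>xs. - c xs :: 'f::field) \<in> boundaries \<K> k"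
  using submodule.smult_closed[OF boundaries_submodule[OF finite_complex_axioms], of "-1" c]
  by (simp add: cycle_space_def)

lemma coset_subset:
  assumes "(\<lambda>xs. c xs - d xs :: 'f::field) \<in> boundaries \<K> k"
  shows "boundaries \<K> k +>\<^bsub>cycle_space \<K> k\<^esub> c \<subseteq> boundaries \<K> k +>\<^bsub>cycle_space \<K> k\<^esub> d"
  unfolding coset_eq
proof
  fix x assume "x \<in> {\<lambda>xs. b xs + c xs |b. b \<in> boundaries \<K> k}"
  then obtain b where "b \<in> boundaries \<K> k" "x = (\<lambda>xs. b xs + c xs)" by blast
  then show "x \<in> {\<lambda>xs. b xs + d xs |b. b \<in> boundaries \<K> k}"
    using boundaries_add[OF _ assms] by (auto intro!: exI[of _ "\<lambda>xs. b xs + (c xs - d xs)"])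
qed

lemma coset_eqI:
  assumes "(\<lambda>xs. c xs - d xs :: 'f::field) \<in> boundaries \<K> k"
  shows "boundaries \<K> k +>\<^bsub>cycle_space \<K> k\<^esub> c = boundaries \<K> k +>\<^bsub>cycle_space \<K> k\<^esub> d"
  using coset_subset[OF assms] coset_subset[of d c k] boundaries_uminus[OF assms] by auto

end

text \<open>The vertices of \<open>V\<close> are switched from \<open>f\<close> to \<open>g\<close>
  one at a time. All intermediate images of a simplex lie in the union of its images under
  \<open>f\<close> and \<open>g\<close>, so every intermediate map is simplicial and contiguous to
  the next.\<close>

lemma contiguous_homologous:
  fixes c :: "'a list \<Rightarrow> 'f::field"
  assumes "simplicial_map V \<K> W \<L> f" "g \<in> V \<rightarrow> W"
    and contiguous: "\<And>\<sigma>. \<sigma> \<in> \<K> \<Longrightarrow> f ` \<sigma> \<union> g ` \<sigma> \<in> \<L>"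
    and c: "c \<in> cycles \<K> k"
  shows "(\<lambda>ys. pushforward V g c ys - pushforward V f c ys) \<in> boundaries \<L> k"
proof -
  interpret simplicial_map V \<K> W \<L> f by fact
  define h where "h S = (\<lambda>x. if x \<in> S then g x else f x)" for S
  \<comment> \<open>\<open>finite_complex\<close> permits the empty set as a simplex, while
    \<open>down\<close> yields only nonempty faces; if \<open>\<tau>\<close> is empty, it is the
    image of the empty \<open>\<sigma>\<close> under \<open>f\<close>.\<close>
  have sub: "\<tau> \<in> \<L>" if "\<sigma> \<in> \<K>" "\<tau> \<subseteq> f ` \<sigma> \<union> g ` \<sigma>" "\<tau> = {} \<longrightarrow> \<sigma> = {}" for \<sigma> \<tau>
    using L.down[OF contiguous[OF that(1)] that(2)] map_simplex[OF that(1)] that(3) by fastforce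
  have "(\<lambda>ys. pushforward V (h S) c ys - pushforward V f c ys) \<in> boundaries \<L> k" if "S \<subseteq> V" for S
    using finite_subset[OF that finite_vertices(1)] that
  proof (induction S)
    case empty
    have "h {} = f" by (simp add: h_def)
    then show ?case using L.boundaries_zero by simp
  next
    case (insert v S)
    have hS: "simplicial_map V \<K> W \<L> (h S)"
    proof (intro simplicial_map.intro simplicial_map_axioms.intro K.finite_complex_axioms
        L.finite_complex_axioms finite_vertices vertices)
      show "h S \<in> V \<rightarrow> W" using map_vertex assms(2) by (auto simp: h_def)
      show "h S ` \<sigma> \<in> \<L>" if "\<sigma> \<in> \<K>" for \<sigma>
        by (rule sub[OF that]) (auto simp: h_def)
    qed
    have "(\<lambda>ys. pushforward V (h (insert v S)) c ys - pushforward V (h S) c ys) \<in> boundaries \<L> k"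
    proof (rule simplicial_map.change_vertex_homologous[OF hS, where v = v])
      show "h (insert v S) v \<in> W" using insert.prems assms(2) by (auto simp: h_def)
      show "h S ` \<sigma> \<union> h (insert v S) ` \<sigma> \<in> \<L>" if "\<sigma> \<in> \<K>" for \<sigma>
        by (rule sub[OF that]) (auto simp: h_def)
    qed (use insert.prems c in \<open>auto simp: h_def\<close>)
    \<comment> \<open>The differences telescope.\<close>
    from L.boundaries_add[OF this insert.IH] insert.prems show ?case by simp
  qed
  then have "(\<lambda>ys. pushforward V (h V) c ys - pushforward V f c ys) \<in> boundaries \<L> k" by blast
  \<comment> \<open>Outside \<open>V\<close> the map \<open>h V\<close> is still \<open>f\<close>,
    but \<open>pushforward V\<close> evaluates it on \<open>V\<close> only.\<close>
  moreover have "pushforward V (h V) c ys = pushforward V g c ys" for ys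
    by (rule pushforward_cong_on) (simp add: h_def)
  ultimately show ?thesis by simp
qed

section \<open>Induced maps on homology\<close>

definition homology_map ::
  "'a set \<Rightarrow> ('a \<Rightarrow> 'b) \<Rightarrow> 'b set set \<Rightarrow> nat \<Rightarrow> ('a list \<Rightarrow> 'f::field) set \<Rightarrow> ('b list \<Rightarrow> 'f) set" where
  "homology_map V f \<L> k A = (\<Union>c\<in>A. boundaries \<L> k +>\<^bsub>cycle_space \<L> k\<^esub> pushforward V f c)"

context simplicial_map
begin

text \<open>Boundaries are pushed to boundaries, so all cosets in the union coincide and no
  representative has to be chosen.\<close>

lemma homology_map_coset:
  "homology_map V f \<L> k (boundaries \<K> k +>\<^bsub>cycle_space \<K> k\<^esub> c)
    = boundaries \<L> k +>\<^bsub>cycle_space \<L> k\<^esub> (pushforward V f c :: 'b list \<Rightarrow> 'f::field)"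
proof -
  have *: "boundaries \<L> k +>\<^bsub>cycle_space \<L> k\<^esub> pushforward V f (\<lambda>xs. b xs + c xs)
      = boundaries \<L> k +>\<^bsub>cycle_space \<L> k\<^esub> pushforward V f c" if "b \<in> boundaries \<K> k" for b
    by (rule L.coset_eqI) (simp add: pushforward_add pushforward_boundaries[OF that])
  have "homology_map V f \<L> k (boundaries \<K> k +>\<^bsub>cycle_space \<K> k\<^esub> c)
      = (\<Union>b\<in>boundaries \<K> k. boundaries \<L> k +>\<^bsub>cycle_space \<L> k\<^esub> pushforward V f (\<lambda>xs. b xs + c xs))"
    unfolding homology_map_def coset_eq[of \<K> k \<K>] by blast
  moreover have "(\<lambda>_. 0 :: 'f) \<in> boundaries \<K> k" by (rule K.boundaries_zero)
  ultimately show ?thesis using * by auto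
qed

lemma homology_map_linear:
  "linear_map class_ring (homology \<K> k :: ('f::field, ('a list \<Rightarrow> 'f) set) module) (homology \<L> k)
    (homology_map V f \<L> k)"
proof -
  note Q = quotient_vectorspace(3,4)[OF cycle_space_vectorspace boundaries_submodule, folded homology_def]
  note cK = homology_carrier[OF K.finite_complex_axioms] and cL = homology_carrier[OF L.finite_complex_axioms]
  have VK: "vectorspace class_ring (homology \<K> k :: ('f, ('a list \<Rightarrow> 'f) set) module)"
    and VL: "vectorspace class_ring (homology \<L> k :: ('f, ('b list \<Rightarrow> 'f) set) module)"
    using homology_vectorspace K.finite_complex_axioms L.finite_complex_axioms by blast+
  \<comment> \<open>This fact and \<open>scale\<close> are stated over a fresh vertex type, so that
    they apply to both \<open>\<K>\<close> and \<open>\<L>\<close>.\<close>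
  have sum: "(boundaries \<M> k +>\<^bsub>cycle_space \<M> k\<^esub> c) \<oplus>\<^bsub>homology \<M> k\<^esub> (boundaries \<M> k +>\<^bsub>cycle_space \<M> k\<^esub> d)
      = boundaries \<M> k +>\<^bsub>cycle_space \<M> k\<^esub> (\<lambda>xs. c xs + d xs)"
    if "finite_complex \<M>" "c \<in> cycles \<M> k" "d \<in> cycles \<M> k" for \<M> and c d :: "'x list \<Rightarrow> 'f"
    using Q(1)[OF that(1), of c k d] that(2,3) by (simp add: cycle_space_def)
  have scale: "a \<odot>\<^bsub>homology \<M> k\<^esub> (boundaries \<M> k +>\<^bsub>cycle_space \<M> k\<^esub> c)
      = boundaries \<M> k +>\<^bsub>cycle_space \<M> k\<^esub> (\<lambda>xs. a * c xs)"
    if "finite_complex \<M>" "c \<in> cycles \<M> k" for \<M> and c :: "'x list \<Rightarrow> 'f" and a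
    using Q(2)[OF that(1), of c k a] that(2) by (simp add: cycle_space_def)
  have "homology_map V f \<L> k \<in> module_hom class_ring (homology \<K> k :: ('f, ('a list \<Rightarrow> 'f) set) module) (homology \<L> k)"
    unfolding module_hom_def cK cL
  proof (intro CollectI conjI allI impI)
    show "homology_map V f \<L> k \<in> (+>\<^bsub>cycle_space \<K> k\<^esub>) (boundaries \<K> k) ` cycles \<K> k
      \<rightarrow> (+>\<^bsub>cycle_space \<L> k\<^esub>) (boundaries \<L> k) ` (cycles \<L> k :: ('b list \<Rightarrow> 'f) set)"
      by (auto simp: homology_map_coset intro!: imageI pushforward_cycle)
  next
    fix A B :: "('a list \<Rightarrow> 'f) set"
    assume "A \<in> (+>\<^bsub>cycle_space \<K> k\<^esub>) (boundaries \<K> k) ` cycles \<K> k \<and> B \<in> (+>\<^bsub>cycle_space \<K> k\<^esub>) (boundaries \<K> k) ` cycles \<K> k"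
    then obtain c d where cd: "c \<in> cycles \<K> k" "A = boundaries \<K> k +>\<^bsub>cycle_space \<K> k\<^esub> c"
      "d \<in> cycles \<K> k" "B = boundaries \<K> k +>\<^bsub>cycle_space \<K> k\<^esub> d" by blast
    show "homology_map V f \<L> k (A \<oplus>\<^bsub>homology \<K> k\<^esub> B)
        = homology_map V f \<L> k A \<oplus>\<^bsub>homology \<L> k\<^esub> homology_map V f \<L> k B"
      using cd by (simp add: sum[OF K.finite_complex_axioms] sum[OF L.finite_complex_axioms]
          homology_map_coset pushforward_cycle pushforward_add)
  next
    fix a :: 'f and A :: "('a list \<Rightarrow> 'f) set"
    assume "a \<in> carrier class_ring \<and> A \<in> (+>\<^bsub>cycle_space \<K> k\<^esub>) (boundaries \<K> k) ` cycles \<K> k"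
    then obtain c where cd: "c \<in> cycles \<K> k" "A = boundaries \<K> k +>\<^bsub>cycle_space \<K> k\<^esub> c" by blast
    show "homology_map V f \<L> k (a \<odot>\<^bsub>homology \<K> k\<^esub> A) = a \<odot>\<^bsub>homology \<L> k\<^esub> homology_map V f \<L> k A"
      using cd by (simp add: scale[OF K.finite_complex_axioms] scale[OF L.finite_complex_axioms]
          homology_map_coset pushforward_cycle pushforward_scale)
  qed
  then show ?thesis
    using VK VL by (simp add: linear_map_def mod_hom_def mod_hom_axioms_def vectorspace_def)
qed

end

section \<open>Interleavings from isometries\<close>

lemma vietoris_rips_iff:
  assumes "finite X"
  shows "\<sigma> \<in> vietoris_rips X d \<delta> \<longleftrightarrow> \<sigma> \<noteq> {} \<and> \<sigma> \<subseteq> X \<and> (\<forall>x\<in>\<sigma>. \<forall>x'\<in>\<sigma>. d x x' \<le> \<delta>)"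
proof -
  have "diam d \<sigma> \<le> \<delta> \<longleftrightarrow> (\<forall>x\<in>\<sigma>. \<forall>x'\<in>\<sigma>. d x x' \<le> \<delta>)" if "\<sigma> \<noteq> {}" "\<sigma> \<subseteq> X"
  proof -
    have "finite \<sigma>" using that(2) assms finite_subset by blast
    then show ?thesis unfolding diam_def using that(1) by (subst Max_le_iff) auto
  qed
  then show ?thesis unfolding vietoris_rips_def by blast
qed

lemma vietoris_rips_simplicial_map:
  assumes "finite X" "finite Y" "\<phi> \<in> X \<rightarrow> Y"
    and "\<And>x x'. x \<in> X \<Longrightarrow> x' \<in> X \<Longrightarrow> dY (\<phi> x) (\<phi> x') \<le> dX x x' + \<eta>"
  shows "simplicial_map X (vietoris_rips X dX s) Y (vietoris_rips Y dY (s + \<eta>)) \<phi>"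
proof (intro simplicial_map.intro vietoris_rips_complex assms(1,2) simplicial_map_axioms.intro assms(3))
  fix \<sigma> assume \<sigma>: "\<sigma> \<in> vietoris_rips X dX s"
  have "dY (\<phi> x) (\<phi> x') \<le> s + \<eta>" if "x \<in> \<sigma>" "x' \<in> \<sigma>" for x x'
    using assms(4)[of x x'] \<sigma> that unfolding vietoris_rips_iff[OF assms(1)] by fastforce
  then show "\<phi> ` \<sigma> \<in> vietoris_rips Y dY (s + \<eta>)"
    using \<sigma> assms(3) unfolding vietoris_rips_iff[OF assms(1)] vietoris_rips_iff[OF assms(2)] by blast
qed (auto simp: vietoris_rips_def)

lemma eta_isometryD:
  assumes "finite X" "finite Y" "eta_isometry X dX Y dY \<eta> \<phi> \<psi>"
  shows "\<phi> \<in> X \<rightarrow> Y" "\<psi> \<in> Y \<rightarrow> X"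
    and "x \<in> X \<Longrightarrow> x' \<in> X \<Longrightarrow> \<bar>dX x x' - dY (\<phi> x) (\<phi> x')\<bar> \<le> \<eta>"
    and "y \<in> Y \<Longrightarrow> y' \<in> Y \<Longrightarrow> \<bar>dY y y' - dX (\<psi> y) (\<psi> y')\<bar> \<le> \<eta>"
    and "x \<in> X \<Longrightarrow> y \<in> Y \<Longrightarrow> \<bar>dX x (\<psi> y) - dY y (\<phi> x)\<bar> \<le> \<eta>"
proof -
  have Max: "(\<lambda>(a, b). g a b) z \<le> \<eta>" if "Max ((\<lambda>(a, b). g a b) ` S) \<le> \<eta>" "finite S" "z \<in> S"
    for g :: "'x \<Rightarrow> 'y \<Rightarrow> real" and S z
    using Max_ge[OF finite_imageI[OF that(2)] imageI[OF that(3)]] that(1) by (rule order_trans)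
  note e = assms(3)[unfolded eta_isometry_def distortion_def codistortion_def]
  show "\<phi> \<in> X \<rightarrow> Y" "\<psi> \<in> Y \<rightarrow> X" using e by blast+
  show "x \<in> X \<Longrightarrow> x' \<in> X \<Longrightarrow> \<bar>dX x x' - dY (\<phi> x) (\<phi> x')\<bar> \<le> \<eta>"
    using e assms(1) Max[of "\<lambda>x x'. \<bar>dX x x' - dY (\<phi> x) (\<phi> x')\<bar>" "X \<times> X" "(x, x')"] by simp
  show "y \<in> Y \<Longrightarrow> y' \<in> Y \<Longrightarrow> \<bar>dY y y' - dX (\<psi> y) (\<psi> y')\<bar> \<le> \<eta>"
    using e assms(2) Max[of "\<lambda>y y'. \<bar>dY y y' - dX (\<psi> y) (\<psi> y')\<bar>" "Y \<times> Y" "(y, y')"] by simp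
  show "x \<in> X \<Longrightarrow> y \<in> Y \<Longrightarrow> \<bar>dX x (\<psi> y) - dY y (\<phi> x)\<bar> \<le> \<eta>"
    using e assms(1,2) Max[of "\<lambda>x y. \<bar>dX x (\<psi> y) - dY y (\<phi> x)\<bar>" "X \<times> Y" "(x, y)"] by simp
qed

text \<open>Allows each interleaving identity to be proved in one direction only. In the
  codistortion the two distances merely trade places inside the absolute value.\<close>

lemma eta_isometry_sym:
  assumes "finite X" "X \<noteq> {}" "finite Y" "Y \<noteq> {}" "eta_isometry X dX Y dY \<eta> \<phi> \<psi>"
  shows "eta_isometry Y dY X dX \<eta> \<psi> \<phi>"
proof -
  have "codistortion Y dY X dX \<psi> \<phi> \<le> \<eta>"
    unfolding codistortion_def
    using eta_isometryD(5)[OF assms(1,3,5)] assms(1-4)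
    by (subst Max_le_iff) (auto simp: abs_minus_commute)
  then show ?thesis using assms(5) unfolding eta_isometry_def by blast
qed

section \<open>Interleaving identities for a fixed isometry\<close>

context
  fixes X :: "'a set" and dX :: "'a \<Rightarrow> 'a \<Rightarrow> real" and Y :: "'b set" and dY :: "'b \<Rightarrow> 'b \<Rightarrow> real"
    and \<eta> :: real and \<phi> :: "'a \<Rightarrow> 'b" and \<psi> :: "'b \<Rightarrow> 'a"
  assumes fin: "finite X" "finite Y" and metric: "Metric_space X dX" and nonneg: "0 \<le> \<eta>"
    and iso: "eta_isometry X dX Y dY \<eta> \<phi> \<psi>"
begin

lemma isometry_simplicial_map:
  "simplicial_map X (vietoris_rips X dX s) Y (vietoris_rips Y dY (s + \<eta>)) \<phi>"
  "simplicial_map Y (vietoris_rips Y dY s) X (vietoris_rips X dX (s + \<eta>)) \<psi>"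
proof -
  note D = eta_isometryD[OF fin iso]
  have "dY (\<phi> x) (\<phi> x') \<le> dX x x' + \<eta>" if "x \<in> X" "x' \<in> X" for x x'
    using D(3)[OF that] by (simp add: abs_le_iff)
  then show "simplicial_map X (vietoris_rips X dX s) Y (vietoris_rips Y dY (s + \<eta>)) \<phi>"
    by (rule vietoris_rips_simplicial_map[OF fin D(1)])
  have "dX (\<psi> y) (\<psi> y') \<le> dY y y' + \<eta>" if "y \<in> Y" "y' \<in> Y" for y y'
    using D(4)[OF that] by (simp add: abs_le_iff)
  then show "simplicial_map Y (vietoris_rips Y dY s) X (vietoris_rips X dX (s + \<eta>)) \<psi>"
    by (rule vietoris_rips_simplicial_map[OF fin(2,1) D(2)])
qed

text \<open>The mixed distances are where the codistortion enters: taken at \<open>x\<close> and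
  \<open>\<phi> x'\<close>, it bounds \<open>dX x (\<psi> (\<phi> x'))\<close> by
  \<open>dY (\<phi> x') (\<phi> x) + \<eta>\<close>, and the distortion of \<open>\<phi>\<close>
  adds another \<open>\<eta>\<close>. Pairs of images use both distortions.\<close>

lemma isometry_contiguous:
  assumes "\<sigma> \<in> vietoris_rips X dX s"
  shows "(\<psi> \<circ> \<phi>) ` \<sigma> \<union> id ` \<sigma> \<in> vietoris_rips X dX (s + 2 * \<eta>)"
proof -
  note D = eta_isometryD[OF fin iso]
  have \<sigma>: "\<sigma> \<noteq> {}" "\<sigma> \<subseteq> X" and s: "\<And>x x'. x \<in> \<sigma> \<Longrightarrow> x' \<in> \<sigma> \<Longrightarrow> dX x x' \<le> s"
    using assms unfolding vietoris_rips_iff[OF fin(1)] by auto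
  have *: "dX x x' \<le> s + 2 * \<eta> \<and> dX x (\<psi> (\<phi> x')) \<le> s + 2 * \<eta> \<and> dX (\<psi> (\<phi> x')) x \<le> s + 2 * \<eta>
      \<and> dX (\<psi> (\<phi> x)) (\<psi> (\<phi> x')) \<le> s + 2 * \<eta>" if "x \<in> \<sigma>" "x' \<in> \<sigma>" for x x'
  proof -
    have X: "x \<in> X" "x' \<in> X" "\<phi> x \<in> Y" "\<phi> x' \<in> Y" using that \<sigma> D(1) by auto
    show ?thesis
      using D(3)[OF X(1,2)] D(3)[OF X(2,1)] D(4)[OF X(3,4)] D(5)[OF X(1,4)]
        s[OF that] s[OF that(2,1)] nonneg Metric_space.commute[OF metric, of x "\<psi> (\<phi> x')"]
      by (simp add: abs_le_iff)
  qed
  show ?thesis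
    unfolding vietoris_rips_iff[OF fin(1)] using \<sigma> D(1,2) * by auto
qed

lemma isometry_homology_comp:
  assumes "A \<in> carrier (homology (vietoris_rips X dX s) k :: ('f::field, ('a list \<Rightarrow> 'f) set) module)"
  shows "homology_map Y \<psi> (vietoris_rips X dX (s + \<eta> + \<eta>)) k (homology_map X \<phi> (vietoris_rips Y dY (s + \<eta>)) k A)
    = homology_inclusion (vietoris_rips X dX (s + 2 * \<eta>)) k A"
proof -
  note C = vietoris_rips_complex[OF fin(1)]
  let ?K = "vietoris_rips X dX s" and ?L = "vietoris_rips X dX (s + 2 * \<eta>)"
  have two: "s + \<eta> + \<eta> = s + 2 * \<eta>" by simp
  have le: "?K \<subseteq> ?L" by (rule vietoris_rips_mono) (simp add: nonneg)
  obtain c where c: "c \<in> cycles ?K k" "A = boundaries ?K k +>\<^bsub>cycle_space ?K k\<^esub> c"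
    using assms unfolding homology_carrier[OF C] by blast
  have \<phi>: "\<phi> \<in> X \<rightarrow> Y" and \<psi>: "\<psi> \<in> Y \<rightarrow> X" using iso unfolding eta_isometry_def by auto
  have S: "simplicial_map X ?K X ?L (\<psi> \<circ> \<phi>)"
  proof (intro simplicial_map.intro C simplicial_map_axioms.intro fin)
    fix \<sigma> assume "\<sigma> \<in> ?K"
    from simplicial_map.map_simplex[OF isometry_simplicial_map(2)
        simplicial_map.map_simplex[OF isometry_simplicial_map(1) this]]
    show "(\<psi> \<circ> \<phi>) ` \<sigma> \<in> ?L" by (simp add: image_comp two)
  qed (use \<phi> \<psi> in \<open>auto simp: vietoris_rips_def\<close>)
  \<comment> \<open>On chains the inclusion is the pushforward along \<open>id\<close>, so the claim
    becomes contiguity of \<open>\<psi> \<circ> \<phi>\<close> and \<open>id\<close>.\<close>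
  have "(\<lambda>ys. pushforward X id c ys - pushforward X (\<psi> \<circ> \<phi>) c ys) \<in> boundaries ?L k"
    by (rule contiguous_homologous[OF S _ isometry_contiguous c(1)]) auto
  moreover have "pushforward X id c ys = c ys" for ys
  proof (rule pushforward_id[OF fin(1)])
    show "set xs \<subseteq> X" if "c xs \<noteq> 0" for xs
      using c(1) that by (auto simp: cycles_def chains_iff_adj vietoris_rips_def)
  qed
  ultimately have "boundaries ?L k +>\<^bsub>cycle_space ?L k\<^esub> c
      = boundaries ?L k +>\<^bsub>cycle_space ?L k\<^esub> pushforward X (\<psi> \<circ> \<phi>) c"
    by (intro finite_complex.coset_eqI[OF C]) simp
  also have "pushforward X (\<psi> \<circ> \<phi>) c = pushforward Y \<psi> (pushforward X \<phi> c)"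
    by (rule ext) (simp add: pushforward_comp[OF fin \<phi>] comp_def)
  finally show ?thesis
    unfolding c(2) homology_inclusion_coset[OF C le C] two
      simplicial_map.homology_map_coset[OF isometry_simplicial_map(1)]
      simplicial_map.homology_map_coset[OF isometry_simplicial_map(2), of "s + \<eta>", unfolded two]
    by (rule sym)
qed

text \<open>Both sides send the class of a cycle \<open>c\<close> to the class of
  \<open>pushforward X \<phi> c\<close>, a chain that does not depend on the scale.\<close>

lemma isometry_homology_natural:
  assumes "s \<le> t" "A \<in> carrier (homology (vietoris_rips X dX s) k :: ('f::field, ('a list \<Rightarrow> 'f) set) module)"
  shows "homology_map X \<phi> (vietoris_rips Y dY (t + \<eta>)) k (homology_inclusion (vietoris_rips X dX t) k A)
    = homology_inclusion (vietoris_rips Y dY (t + \<eta>)) k (homology_map X \<phi> (vietoris_rips Y dY (s + \<eta>)) k A)"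
proof -
  note CX = vietoris_rips_complex[OF fin(1)] and CY = vietoris_rips_complex[OF fin(2)]
  have le: "vietoris_rips X dX s \<subseteq> vietoris_rips X dX t"
    "vietoris_rips Y dY (s + \<eta>) \<subseteq> vietoris_rips Y dY (t + \<eta>)"
    using assms(1) by (simp_all add: vietoris_rips_mono)
  show ?thesis
    using assms(2) unfolding homology_carrier[OF CX]
    by (auto simp: homology_inclusion_coset[OF CX le(1) CX] homology_inclusion_coset[OF CY le(2) CY]
        simplicial_map.homology_map_coset[OF isometry_simplicial_map(1)])
qed

end

lemma isometry_interleaved:
  assumes "Metric_space X dX" "finite X" "X \<noteq> {}" "Metric_space Y dY" "finite Y" "Y \<noteq> {}"
    and "0 \<le> \<eta>" "eta_isometry X dX Y dY \<eta> \<phi> \<psi>"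
  shows "interleaved (class_ring :: 'f::field ring)
    (vietoris_rips_homology k X dX) (vietoris_rips_homology k Y dY) \<eta>"
proof -
  note I = assms(2,5,1,7,8)
  \<comment> \<open>\<open>J\<close> is \<open>I\<close> with the roles of the two spaces and of the
    two maps exchanged; it supplies the second identity of each pair.\<close>
  note J = assms(5,2,4,7) eta_isometry_sym[OF assms(2,3,5,6,8)]
  show ?thesis
    unfolding interleaved_def interleaving_def vietoris_rips_homology_def persistence.simps
    by (intro exI[of _ "\<lambda>s. homology_map X \<phi> (vietoris_rips Y dY (s + \<eta>)) k"]
        exI[of _ "\<lambda>s. homology_map Y \<psi> (vietoris_rips X dX (s + \<eta>)) k"] conjI allI impI ballI
        isometry_simplicial_map[OF I, THEN simplicial_map.homology_map_linear]
        isometry_homology_comp[OF I] isometry_homology_comp[OF J]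
        isometry_homology_natural[OF I] isometry_homology_natural[OF J])
qed

text \<open>A \<open>LEAST\<close> over the reals is meaningful only if attained. The optimal value
  for each pair of maps lies in the finite set \<open>D\<close> of differences of distances, so the
  minimum over a finite set of candidates is the overall minimum.\<close>

lemma gromov_hausdorff_attained:
  assumes "finite X" "X \<noteq> {}" "finite Y" "Y \<noteq> {}"
  obtains \<phi> \<psi> where "0 \<le> 2 * gromov_hausdorff X dX Y dY"
    "eta_isometry X dX Y dY (2 * gromov_hausdorff X dX Y dY) \<phi> \<psi>"
proof -
  define P where "P \<eta> \<longleftrightarrow> 0 \<le> \<eta> \<and> (\<exists>\<phi> \<psi>. eta_isometry X dX Y dY \<eta> \<phi> \<psi>)" for \<eta>
  define D where "D = (\<lambda>(x, x', y, y'). \<bar>dX x x' - dY y y'\<bar>) ` (X \<times> X \<times> Y \<times> Y)"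
  have D: "finite D" "\<And>r. r \<in> D \<Longrightarrow> 0 \<le> r" unfolding D_def using assms by auto
  have memD: "\<bar>dX x x' - dY y y'\<bar> \<in> D" "\<bar>dY y y' - dX x x'\<bar> \<in> D"
    if "x \<in> X" "x' \<in> X" "y \<in> Y" "y' \<in> Y" for x x' y y'
    unfolding D_def using that by (auto simp: image_iff abs_minus_commute)
  have small: "\<exists>m\<in>D. P m \<and> (\<forall>\<eta>. eta_isometry X dX Y dY \<eta> \<phi> \<psi> \<longrightarrow> m \<le> \<eta>)"
    if \<phi>: "\<phi> \<in> X \<rightarrow> Y" and \<psi>: "\<psi> \<in> Y \<rightarrow> X" for \<phi> \<psi>
  proof -
    \<comment> \<open>The smallest value for which this particular pair is an isometry.\<close>
    let ?m = "max (distortion X dX dY \<phi>) (max (distortion Y dY dX \<psi>) (codistortion X dX Y dY \<phi> \<psi>))"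
    have mapsto: "\<And>x. x \<in> X \<Longrightarrow> \<phi> x \<in> Y" "\<And>y. y \<in> Y \<Longrightarrow> \<psi> y \<in> X"
      using \<phi> \<psi> by auto
    have "distortion X dX dY \<phi> \<in> D" unfolding distortion_def
      using assms by (intro subsetD[OF _ Max_in]) (auto intro!: memD mapsto)
    moreover have "distortion Y dY dX \<psi> \<in> D" unfolding distortion_def
      using assms by (intro subsetD[OF _ Max_in]) (auto intro!: memD mapsto)
    moreover have "codistortion X dX Y dY \<phi> \<psi> \<in> D" unfolding codistortion_def
      using assms by (intro subsetD[OF _ Max_in]) (auto intro!: memD mapsto)
    ultimately have "?m \<in> D" by (simp add: max_def)
    moreover have "eta_isometry X dX Y dY ?m \<phi> \<psi>" using \<phi> \<psi> by (simp add: eta_isometry_def le_max_iff_disj)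
    moreover have "?m \<le> \<eta>" if "eta_isometry X dX Y dY \<eta> \<phi> \<psi>" for \<eta>
      using that by (simp add: eta_isometry_def)
    ultimately show ?thesis using D(2) unfolding P_def by blast
  qed
  let ?M = "{m \<in> D. P m}"
  obtain x y where "x \<in> X" "y \<in> Y" using assms by blast
  \<comment> \<open>Constant maps form a pair, so there is at least one candidate.\<close>
  then have "?M \<noteq> {}" using small[of "\<lambda>_. y" "\<lambda>_. x"] by auto
  then have "Min ?M \<in> ?M" using D(1) by (intro Min_in) auto
  moreover have "Min ?M \<le> \<eta>" if P: "P \<eta>" for \<eta>
  proof -
    obtain \<phi> \<psi> where iso: "eta_isometry X dX Y dY \<eta> \<phi> \<psi>" using P unfolding P_def by blast
    then obtain m where "m \<in> ?M" "m \<le> \<eta>" using small[of \<phi> \<psi>] by (auto simp: eta_isometry_def)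
    moreover have "finite ?M" using D(1) by simp
    ultimately show ?thesis using Min_le order_trans by blast
  qed
  ultimately have "(LEAST \<eta>. P \<eta>) = Min ?M" "P (Min ?M)" by (auto intro!: Least_equality)
  then have "P (2 * gromov_hausdorff X dX Y dY)"
    unfolding gromov_hausdorff_def P_def[symmetric] by simp
  then show ?thesis using that unfolding P_def by blast
qed

theorem theorem5p10:
  fixes X :: "'a set" and dX :: "'a \<Rightarrow> 'a \<Rightarrow> real"
    and Y :: "'b set" and dY :: "'b \<Rightarrow> 'b \<Rightarrow> real"
    and k :: nat
  assumes "Metric_space X dX" "finite X" "X \<noteq> {}"
    and "Metric_space Y dY" "finite Y" "Y \<noteq> {}"
  shows "ereal (2 * gromov_hausdorff X dX Y dY) \<ge>
    interleaving_distance (class_ring :: 'f::field ring)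
      (vietoris_rips_homology k X dX) (vietoris_rips_homology k Y dY)"
proof -
  let ?\<eta> = "2 * gromov_hausdorff X dX Y dY"
  obtain \<phi> \<psi> where \<eta>: "0 \<le> ?\<eta>" "eta_isometry X dX Y dY ?\<eta> \<phi> \<psi>"
    using gromov_hausdorff_attained[OF assms(2,3,5,6)] .
  have "interleaved (class_ring :: 'f ring) (vietoris_rips_homology k X dX) (vietoris_rips_homology k Y dY) ?\<eta>"
    by (rule isometry_interleaved[OF assms \<eta>])
  \<comment> \<open>Because the minimum is attained, twice the Gromov-Hausdorff distance itself
    belongs to the set whose infimum is the interleaving distance; no limit is taken.\<close>
  then show ?thesis
    unfolding interleaving_distance_def using \<eta>(1) by (intro INF_lower) simp
qed

end
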